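(* For any $\lambda\ge1$, there exists a constant $C(\lambda)$ depending on $\lambda$ only such that for any polynomial $P$ which is an eigenvector of the deltoid operator $L^{(\lambda)}$ with eigenvalue $\mu\neq0$, in the sense that $L^{(\lambda)}P=-\mu P$, one has $$\|P\|_\infty\le C(\lambda)\,\mu^{\lambda/2}\,\|P\|_2 .$$
   Context: Deltoid domain: let $D\subset\mathbb{R}^2\simeq\mathbb{C}$ be the bounded open domain containing $0$ whose boundary is the deltoid curve $t\mapsto \frac13(2e^{it}+e^{-2it})$. Write $Z=x+iy$, $\bar Z=x-iy$ for the coordinates, $\partial_Z,\partial_{\bar Z}$ for the usual complex derivatives. For a real parameter $\lambda>0$, the deltoid operator is $$L^{(\lambda)}f=(\bar Z-Z^2)\,\partial_Z^2 f+(1-Z\bar Z)\,\partial_Z\partial_{\bar Z}f+(Z-\bar Z^2)\,\partial_{\bar Z}^2f-\lambda\,(Z\partial_Z f+\bar Z\partial_{\bar Z} f).$$ Its reversible probability measure $\mu^{(\lambda)}$ on $D$ has density $C_\alpha P_0^{\alpha}$ with respect to Lebesgue measure, where $P_0(Z,\bar Z)=\frac14(1-Z\bar Z)^2-(\bar Z-Z^2)(Z-\bar Z^2)$ (positive in $D$), $\alpha=\frac{2\lambda-5}{6}$, and $C_\alpha$ is the normalizing constant. Polynomials are polynomials in $(Z,\bar Z)$ (equivalently in $(x,y)$) restricted to $D$; $\|\cdot\|_2$ is the norm of $L^2(\mu^{(\lambda)})$ and $\|\cdot\|_\infty$ is the supremum norm on $D$. *)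

theory Defs
  imports "HOL-Analysis.Analysis"
begin

definition deltoid_curve :: "real \<Rightarrow> complex" where
  "deltoid_curve t = (2 * exp (\<i> * of_real t) + exp (- 2 * \<i> * of_real t)) / 3"

text \<open>
  The domain is taken to be the connected component of \<open>0\<close> in the complement of the curve;
  the lemma below shows that no other domain containing \<open>0\<close> can have the curve as its boundary.
\<close>

definition deltoid :: "complex set" where
  "deltoid = connected_component_set (- range deltoid_curve) 0"

lemma deltoid_unique:
  assumes "open S" "connected S" "0 \<in> S" "frontier S = range deltoid_curve"
  shows "S = deltoid"
proof
  have "S \<inter> frontier S = {}"
    using assms(1) by (simp add: frontier_def interior_open)
  then show "S \<subseteq> deltoid"
    unfolding deltoid_def using assms by (intro connected_component_maximal) auto
  have "0 \<in> deltoid"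
    using \<open>S \<subseteq> deltoid\<close> assms(3) by blast
  moreover have "deltoid \<inter> frontier S = {}"
    unfolding deltoid_def assms(4) using connected_component_subset by fastforce
  moreover have "connected deltoid"
    unfolding deltoid_def by simp
  ultimately show "deltoid \<subseteq> S"
    using connected_Int_frontier[of deltoid S] assms(3) by blast
qed

text \<open>
  The Wirtinger derivatives \<open>(\<partial>\<^sub>x - \<i> \<partial>\<^sub>y) / 2\<close> and \<open>(\<partial>\<^sub>x + \<i> \<partial>\<^sub>y) / 2\<close>; the Frechet derivative is
  the real one, so its values at \<open>1\<close> and \<open>\<i>\<close> are the partial derivatives in \<open>x\<close> and \<open>y\<close>.
\<close>

definition dZ :: "(complex \<Rightarrow> complex) \<Rightarrow> complex \<Rightarrow> complex" where
  "dZ f z = (frechet_derivative f (at z) 1 - \<i> * frechet_derivative f (at z) \<i>) / 2"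

definition dZbar :: "(complex \<Rightarrow> complex) \<Rightarrow> complex \<Rightarrow> complex" where
  "dZbar f z = (frechet_derivative f (at z) 1 + \<i> * frechet_derivative f (at z) \<i>) / 2"

definition deltoid_operator :: "real \<Rightarrow> (complex \<Rightarrow> complex) \<Rightarrow> complex \<Rightarrow> complex" where
  "deltoid_operator l f z =
     (cnj z - z\<^sup>2) * dZ (dZ f) z
     + (1 - z * cnj z) * dZ (dZbar f) z
     + (z - (cnj z)\<^sup>2) * dZbar (dZbar f) z
     - of_real l * (z * dZ f z + cnj z * dZbar f z)"

text \<open>The expression below is real-valued; \<open>Re\<close> only changes its type.\<close>

definition P0 :: "complex \<Rightarrow> real" where
  "P0 z = Re ((1 - z * cnj z)\<^sup>2 / 4 - (cnj z - z\<^sup>2) * (z - (cnj z)\<^sup>2))"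

definition deltoid_exponent :: "real \<Rightarrow> real" where
  "deltoid_exponent l = (2 * l - 5) / 6"

definition deltoid_const :: "real \<Rightarrow> real" where
  "deltoid_const l = 1 / (LINT z:deltoid|lborel. P0 z powr deltoid_exponent l)"

definition deltoid_measure :: "real \<Rightarrow> complex measure" where
  "deltoid_measure l = density lborel
     (\<lambda>z. indicator deltoid z * ennreal (deltoid_const l * P0 z powr deltoid_exponent l))"

definition L2_norm :: "real \<Rightarrow> (complex \<Rightarrow> complex) \<Rightarrow> real" where
  "L2_norm l f = sqrt (LINT z|deltoid_measure l. (cmod (f z))\<^sup>2)"

definition sup_norm :: "(complex \<Rightarrow> complex) \<Rightarrow> real" where
  "sup_norm f = (SUP z\<in>deltoid. cmod (f z))"

text \<open>
  For \<open>f :: complex \<Rightarrow> complex\<close>, \<open>polynomial_function f\<close> says that \<open>f\<close> is a polynomial in the real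
  coordinates \<open>(x, y)\<close> with complex coefficients, equivalently in \<open>(z, cnj z)\<close>.
\<close>

definition polynomial_eigenvector :: "real \<Rightarrow> real \<Rightarrow> (complex \<Rightarrow> complex) \<Rightarrow> bool" where
  "polynomial_eigenvector l \<mu> f \<longleftrightarrow>
     polynomial_function f \<and> (\<exists>z\<in>deltoid. f z \<noteq> 0) \<and>
     (\<forall>z\<in>deltoid. deltoid_operator l f z = - of_real \<mu> * f z)"

end

theory Submission
  imports Defs
begin

text \<open>
  The boundary curve bounds the set where \<open>P0\<close> is positive, and this set is parametrised by the torus
  via \<open>Z(u, v) = (exp (- 2 \<i> u) + 2 cos v exp (\<i> u)) / 3\<close>. With \<open>W = \<bar>sin v (cos v - cos 3u)\<bar>\<close> one has
  \<open>P0 (Z(u, v)) = 4/27 W\<^sup>2\<close>, and the Jacobian of \<open>Z\<close> is \<open>4/9 W\<close>. Hence a polynomial \<open>f\<close> of degree \<open>n\<close>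
  becomes a trigonometric polynomial of degree \<open>O(n)\<close>, and its norm in \<open>L\<^sup>2(\<mu>)\<close> becomes a norm on the
  torus with weight \<open>W powr b\<close>, \<open>b = (2 l - 2) / 3 \<ge> 0\<close>. By Nikolskii's inequality a trigonometric polynomial
  in \<open>v\<close> cannot concentrate on the small set where \<open>W\<close> is below a constant times \<open>n powr (- 3)\<close>, so the
  weight costs a factor \<open>n powr (3 b)\<close> and \<open>\<bar>f\<bar>\<^sup>2 \<le> C n powr (2 + 3 b) \<parallel>f\<parallel>\<^sup>2 = C n powr (2 l) \<parallel>f\<parallel>\<^sup>2\<close> for every
  polynomial of degree at most \<open>n \<ge> 1\<close>. For an eigenvector, comparing coefficients in top degree \<open>n = i + j\<close> gives
  \<open>\<mu> = i\<^sup>2 + i j + j\<^sup>2 + (l - 1) (i + j) \<ge> 3/4 n\<^sup>2\<close>.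
\<close>

section \<open>Degree and eigenvalue\<close>

text \<open>A polynomial in \<open>z\<close> and \<open>cnj z\<close> is encoded as a
  \<open>poly poly\<close>: the outer variable stands for \<open>z\<close>, the inner one for
  \<open>cnj z\<close>. Real and imaginary parts are treated separately, since the induction
  principle concerns real-valued polynomial functions.\<close>

lemma polynomial_function_eq_poly_poly:
  fixes f :: "complex \<Rightarrow> complex"
  assumes "polynomial_function f"
  shows "\<exists>Q :: complex poly poly. \<forall>z. f z = poly (poly Q [:z:]) (cnj z)"
proof -
  have real: "\<exists>Q :: complex poly poly. \<forall>z. complex_of_real (g z) = poly (poly Q [:z:]) (cnj z)"
    if "real_polynomial_function g" for g :: "complex \<Rightarrow> real"
    using that
  proof (induction g rule: real_polynomial_function.induct)
    case (linear g)
    interpret bounded_linear g by fact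
    \<comment> \<open>With this \<open>a\<close>, \<open>a * z + cnj a * cnj z\<close> is twice the
      real part of \<open>a * z\<close>, which is \<open>Re z * g 1 + Im z * g \<i>\<close>.\<close>
    define a where "a = (complex_of_real (g 1) - \<i> * complex_of_real (g \<i>)) / 2"
    have "complex_of_real (g z) = a * z + cnj a * cnj z" for z
    proof -
      have "z = Re z *\<^sub>R 1 + Im z *\<^sub>R \<i>"
        by (simp add: complex_eq_iff)
      then have "g z = Re z * g 1 + Im z * g \<i>"
        by (metis add scaleR real_scaleR_def)
      then show ?thesis
   
      by (simp add: a_def complex_eq_iff field_simps)
    qed
    then show ?case
      by (intro exI[of _ "[:[:0, cnj a:], [:a:]:]"]) (simp add: algebra_simps)
  next
    case (const c)
    then show ?case
      by (intro exI[of _ "[:[:of_real c:]:]"]) simp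
  next
    case (add f g)
    then obtain Q R where "\<forall>z. complex_of_real (f z) = poly (poly Q [:z:]) (cnj z)"
      "\<forall>z. complex_of_real (g z) = poly (poly R [:z:]) (cnj z)" by blast
    then show ?case
      by (intro exI[of _ "Q + R"]) simp
  next
    case (mult f g)
    then obtain Q R where "\<forall>z. complex_of_real (f z) = poly (poly Q [:z:]) (cnj z)"
      "\<forall>z. complex_of_real (g z) = poly (poly R [:z:]) (cnj z)" by blast
    then show ?case
      by (intro exI[of _ "Q * R"]) simp
  qed
  obtain Q R where "\<forall>z. complex_of_real (Re (f z)) = poly (poly Q [:z:]) (cnj z)"
    "\<forall>z. complex_of_real (Im (f z)) = poly (poly R [:z:]) (cnj z)"
    using assms real[of "Re \<circ> f"] real[of "Im \<circ> f"]
    unfolding polynomial_function_def by (auto simp: bounded_linear_Re bounded_linear_Im)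
  then have "f z = poly (poly (Q + [:[:\<i>:]:] * R) [:z:]) (cnj z)" for z
    by (subst complex_eq) simp
  then show ?thesis by blast
qed

lemma polynomial_function_eq_sum:
  fixes f :: "complex \<Rightarrow> complex"
  assumes "polynomial_function f"
  shows "\<exists>N a. \<forall>z. f z = (\<Sum>i\<le>N. \<Sum>j\<le>N. a i j * z ^ i * cnj z ^ j)"
proof -
  obtain Q :: "complex poly poly" where Q: "\<And>z. f z = poly (poly Q [:z:]) (cnj z)"
    using polynomial_function_eq_poly_poly[OF assms] by blast
  \<comment> \<open>A common bound for the outer degree and all inner degrees lets both sums run
    over \<open>{..N}\<close>; the added coefficients are zero.\<close>
  define N where "N = Max (insert (degree Q) ((\<lambda>i. degree (coeff Q i)) ` {..degree Q}))"
  have N: "degree Q \<le> N" "degree (coeff Q i) \<le> N" for i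
  proof -
    show "degree Q \<le> N" by (simp add: N_def)
    show "degree (coeff Q i) \<le> N"
    proof (cases "i \<le> degree Q")
      case True
      then show ?thesis unfolding N_def by (intro Max_ge) auto
    qed (simp add: coeff_eq_0)
  qed
  have poly_le: "poly q x = (\<Sum>i\<le>N. coeff q i * x ^ i)" if "degree q \<le> N"
    for q :: "'b::comm_semiring_1 poly" and x
    unfolding poly_altdef
    by (rule sum.mono_neutral_left) (use that in \<open>auto simp: coeff_eq_0\<close>)
  have "f z = (\<Sum>i\<le>N. \<Sum>j\<le>N. coeff (coeff Q i) j * z ^ i * cnj z ^ j)" for z
    by (simp add: Q poly_le[OF N(1)] poly_le[OF N(2)] poly_sum sum_distrib_left sum_distrib_right
        mult_ac flip: poly_const_pow)
  then show ?thesis by (intro exI[of _ N] exI[of _ "\<lambda>i j. coeff (coeff Q i) j"]) simp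
qed

section \<open>Wirtinger derivatives and the operator on monomials\<close>

text \<open>The derivative takes the values \<open>A + B\<close> at \<open>1\<close> and
  \<open>\<i> * (A - B)\<close> at \<open>\<i>\<close>, from which the two Wirtinger combinations
  recover \<open>A\<close> and \<open>B\<close>.\<close>

lemma dZ_dZbar_eqI:
  assumes "(f has_derivative (\<lambda>h. A * h + B * cnj h)) (at z)"
  shows "dZ f z = A" "dZbar f z = B"
  using frechet_derivative_at[OF assms, symmetric]
  by (simp_all add: dZ_def dZbar_def algebra_simps)

text \<open>The exponents are arbitrary functions \<open>p\<close> and \<open>q\<close> of the
  indices so that the rule applies again to its own result, as second derivatives require.\<close>

lemma has_derivative_sum_monomials:
  fixes a :: "nat \<Rightarrow> nat \<Rightarrow> complex"
  shows "((\<lambda>z. \<Sum>i\<in>I. \<Sum>j\<in>J. a i j * z ^ p i * cnj z ^ q j) has_derivative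
    (\<lambda>h. (\<Sum>i\<in>I. \<Sum>j\<in>J. (a i j * of_nat (p i)) * z ^ (p i - 1) * cnj z ^ q j) * h +
         (\<Sum>i\<in>I. \<Sum>j\<in>J. (a i j * of_nat (q j)) * z ^ p i * cnj z ^ (q j - 1)) * cnj h)) (at z)"
  by (auto intro!: derivative_eq_intros
      simp: sum_distrib_right sum_distrib_left sum.distrib[symmetric] fun_eq_iff algebra_simps
      intro!: sum.cong)

lemmas dZ_sum_monomials = dZ_dZbar_eqI[OF has_derivative_sum_monomials]


definition deltoid_eigenvalue :: "real \<Rightarrow> nat \<Rightarrow> nat \<Rightarrow> real" where
  "deltoid_eigenvalue l i j = real (i * (i - 1) + i * j + j * (j - 1)) + l * real (i + j)"

text \<open>The first three terms have total degree below \<open>i + j\<close> whenever their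
  integer prefactor is nonzero. The operator is thus triangular with respect to total degree, and
  \<open>- deltoid_eigenvalue l i j\<close> are its diagonal entries.\<close>

lemma deltoid_operator_sum_monomials:
  fixes a :: "nat \<Rightarrow> nat \<Rightarrow> complex"
  shows "deltoid_operator l (\<lambda>z. \<Sum>i\<in>I. \<Sum>j\<in>J. a i j * z ^ i * cnj z ^ j) z = (\<Sum>i\<in>I. \<Sum>j\<in>J. a i j *
     (of_nat (i * (i - 1)) * z ^ (i - 2) * cnj z ^ (j + 1)
      + of_nat (i * j) * z ^ (i - 1) * cnj z ^ (j - 1)
      + of_nat (j * (j - 1)) * z ^ (i + 1) * cnj z ^ (j - 2)
      - of_real (deltoid_eigenvalue l i j) * z ^ i * cnj z ^ j))"
proof -
  define f where "f = (\<lambda>z. \<Sum>i\<in>I. \<Sum>j\<in>J. a i j * z ^ i * cnj z ^ j)"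
  have d: "dZ f = (\<lambda>z. \<Sum>i\<in>I. \<Sum>j\<in>J. (a i j * of_nat i) * z ^ (i - 1) * cnj z ^ j)"
    "dZbar f = (\<lambda>z. \<Sum>i\<in>I. \<Sum>j\<in>J. (a i j * of_nat j) * z ^ i * cnj z ^ (j - 1))"
    unfolding f_def by (auto simp: fun_eq_iff dZ_sum_monomials)
  have e: "(cnj z - z\<^sup>2) * (a i j * of_nat i * of_nat (i - 1) * z ^ (i - 1 - 1) * cnj z ^ j)
     + (1 - z * cnj z) * (a i j * of_nat j * of_nat i * z ^ (i - 1) * cnj z ^ (j - 1))
     + (z - (cnj z)\<^sup>2) * (a i j * of_nat j * of_nat (j - 1) * z ^ i * cnj z ^ (j - 1 - 1))
     - of_real l * (z * (a i j * of_nat i * z ^ (i - 1) * cnj z ^ j)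
          + cnj z * (a i j * of_nat j * z ^ i * cnj z ^ (j - 1)))
    = a i j *
     (of_nat (i * (i - 1)) * z ^ (i - 2) * cnj z ^ (j + 1)
      + of_nat (i * j) * z ^ (i - 1) * cnj z ^ (j - 1)
      + of_nat (j * (j - 1)) * z ^ (i + 1) * cnj z ^ (j - 2)
      - of_real (deltoid_eigenvalue l i j) * z ^ i * cnj z ^ j)" for i j
  proof -
    \<comment> \<open>The small exponents are separated because natural subtraction truncates there;
      the vanishing prefactors then kill the affected terms.\<close>
    consider "i = 0" | "i = 1" | k where "i = Suc (Suc k)"
      by (metis One_nat_def nat.exhaust)
    then show ?thesis
    proof cases
      case 1
      consider "j = 0" | "j = 1" | k where "j = Suc (Suc k)"
        by (metis One_nat_def nat.exhaust)
      then show ?thesis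
        by cases (use 1 in \<open>simp_all add: deltoid_eigenvalue_def algebra_simps power2_eq_square\<close>)
    next
      case 2
      consider "j = 0" | "j = 1" | k where "j = Suc (Suc k)"
        by (metis One_nat_def nat.exhaust)
      then show ?thesis
        by cases (use 2 in \<open>simp_all add: deltoid_eigenvalue_def algebra_simps power2_eq_square\<close>)
    next
      case 3
      consider "j = 0" | "j = 1" | k where "j = Suc (Suc k)"
        by (metis One_nat_def nat.exhaust)
      then show ?thesis
        by cases (use 3 in \<open>simp_all add: deltoid_eigenvalue_def algebra_simps power2_eq_square\<close>)
    qed
  qed
  have "deltoid_operator l f z = (\<Sum>i\<in>I. \<Sum>j\<in>J. 
     (cnj z - z\<^sup>2) * (a i j * of_nat i * of_nat (i - 1) * z ^ (i - 1 - 1) * cnj z ^ j)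
     + (1 - z * cnj z) * (a i j * of_nat j * of_nat i * z ^ (i - 1) * cnj z ^ (j - 1))
     + (z - (cnj z)\<^sup>2) * (a i j * of_nat j * of_nat (j - 1) * z ^ i * cnj z ^ (j - 1 - 1))
     - of_real l * (z * (a i j * of_nat i * z ^ (i - 1) * cnj z ^ j)
          + cnj z * (a i j * of_nat j * z ^ i * cnj z ^ (j - 1))))"
    unfolding deltoid_operator_def d dZ_sum_monomials
    by (simp only: sum_distrib_left sum.distrib sum_subtractf distrib_left)
  also have "\<dots> = (\<Sum>i\<in>I. \<Sum>j\<in>J. a i j *
     (of_nat (i * (i - 1)) * z ^ (i - 2) * cnj z ^ (j + 1)
      + of_nat (i * j) * z ^ (i - 1) * cnj z ^ (j - 1)
      + of_nat (j * (j - 1)) * z ^ (i + 1) * cnj z ^ (j - 2)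
      - of_real (deltoid_eigenvalue l i j) * z ^ i * cnj z ^ j))"
    by (simp only: e)
  finally show ?thesis by (simp only: f_def)
qed

section \<open>The domain is an open neighbourhood of the origin\<close>

lemma deltoid_curve_cis: "deltoid_curve t = (2 * cis t + cis (- 2 * t)) / 3"
  by (simp add: deltoid_curve_def cis_conv_exp mult_ac)

text \<open>Components of an open set are open, so it suffices that the curve is closed; by
  periodicity it is the image of a compact interval.\<close>

lemma open_deltoid: "open deltoid"
proof -
  have "range deltoid_curve = deltoid_curve ` {0..2 * pi}"
  proof -
    have "deltoid_curve t \<in> deltoid_curve ` {0..2 * pi}" for t
    proof -
      obtain s where s: "s \<in> {0..2*pi}" "cis s = cis t"
      proof -
        have "cis (Arg2pi (cis t)) = cis t"
          using Arg2pi_eq[of "cis t"] by (simp add: cis_conv_exp)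
        then show ?thesis using that[of "Arg2pi (cis t)"] Arg2pi_ge_0[of "cis t"] Arg2pi_lt_2pi[of "cis t"]
          by simp
      qed
      have "deltoid_curve x = (2 * cis x + inverse (cis x ^ 2)) / 3" for x
        by (simp add: deltoid_curve_cis Complex.DeMoivre)
      then have "deltoid_curve t = deltoid_curve s" by (simp only: s(2))
      then show ?thesis using s by blast
    qed
    then show ?thesis by auto
  qed
  moreover have "compact (deltoid_curve ` {0..2 * pi})"
    unfolding deltoid_curve_def by (intro compact_continuous_image continuous_intros) auto
  ultimately have "open (- range deltoid_curve)"
    by (simp add: compact_imp_closed open_Compl)
  then show ?thesis
    unfolding deltoid_def by (rule open_connected_component)
qed

text \<open>The two summands of the curve have moduli 2/3 and 1/3, so they never cancel.\<close>

lemma zero_in_deltoid: "0 \<in> deltoid"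
proof -
  have "deltoid_curve t \<noteq> 0" for t
  proof
    assume "deltoid_curve t = 0"
    then have "2 * exp (\<i> * of_real t) = - exp (- 2 * \<i> * of_real t)"
      by (simp add: deltoid_curve_def eq_neg_iff_add_eq_0)
    then have "cmod (2 * exp (\<i> * of_real t)) = cmod (exp (- 2 * \<i> * of_real t))"
      by (metis norm_minus_cancel)
    then show False by (simp add: norm_mult)
  qed
  then have "0 \<in> - range deltoid_curve" by (metis ComplI imageE)
  then show ?thesis
    unfolding deltoid_def by (simp add: connected_component_refl)
qed

section \<open>The eigenvalue is read off in top degree\<close>

lemma poly_eq_0_real_interval:
  fixes p :: "complex poly"
  assumes "r > 0" "\<And>s. 0 < s \<Longrightarrow> s < r \<Longrightarrow> poly p (of_real s) = 0"
  shows "p = 0"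
proof (rule ccontr)
  assume "p \<noteq> 0"
  then have "finite {x. poly p x = 0}" by (rule poly_roots_finite)
  moreover have "complex_of_real ` {0<..<r} \<subseteq> {x. poly p x = 0}"
    using assms by auto
  ultimately have "finite (complex_of_real ` {0<..<r})" by (rule rev_finite_subset)
  then have "finite {0<..<r}"
    by (rule finite_imageD) (auto simp: inj_on_def)
  then show False using assms(1) by (simp add: infinite_Ioo)
qed

text \<open>The eigenvalue equation is known only on the domain, hence on a small ball about 0.
  Along each ray \<open>z = s * u\<close> it is a polynomial identity in \<open>s\<close>, whose
  coefficient at \<open>s ^ n\<close> gives a homogeneous relation in \<open>u\<close> and
  \<open>cnj u\<close> on the unit circle; this forces every \<open>c i\<close> to vanish.\<close>

lemma eigenvalue_top_degree:
  fixes a :: "nat \<Rightarrow> nat \<Rightarrow> complex"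
  assumes f: "\<And>z. f z = (\<Sum>i\<le>n. \<Sum>j\<le>n. a i j * z ^ i * cnj z ^ j)"
    and deg: "\<And>i j. n < i + j \<Longrightarrow> a i j = 0"
    and k: "k \<le> n" "a k (n - k) \<noteq> 0"
    and eig: "\<And>z. z \<in> deltoid \<Longrightarrow> deltoid_operator l f z = - of_real \<mu> * f z"
  shows "\<mu> = deltoid_eigenvalue l k (n - k)"
proof -
  obtain r where r: "r > 0" "ball 0 r \<subseteq> deltoid"
    using open_deltoid zero_in_deltoid open_contains_ball by blast
  define c where "c i = a i (n - i) * of_real (\<mu> - deltoid_eigenvalue l i (n - i))" for i
  have top: "(\<Sum>i\<le>n. c i * u ^ i * cnj u ^ (n - i)) = 0" if "cmod u = 1" for u
  proof -
    \<comment> \<open>Viewed as polynomials in \<open>s\<close> along the ray, \<open>m\<close> is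
      the diagonal part of \<open>L + \<mu>\<close> on a monomial and \<open>t\<close> collects its
      lower-degree terms.\<close>
    define m where "m i j = monom (of_real (\<mu> - deltoid_eigenvalue l i j) * u ^ i * cnj u ^ j) (i + j)"
      for i j
    define t where "t i j = monom (of_nat (i * (i - 1)) * u ^ (i - 2) * cnj u ^ (j + 1)) (i - 2 + (j + 1))
      + monom (of_nat (i * j) * u ^ (i - 1) * cnj u ^ (j - 1)) (i - 1 + (j - 1))
      + monom (of_nat (j * (j - 1)) * u ^ (i + 1) * cnj u ^ (j - 2)) (i + 1 + (j - 2))" for i j
    define p where "p = (\<Sum>i\<le>n. \<Sum>j\<le>n. smult (a i j) (m i j + t i j))"
    have "p = 0"
    proof (rule poly_eq_0_real_interval[OF r(1)])
      fix s :: real assume s: "0 < s" "s < r"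
      define z where "z = of_real s * u"
      have "z \<in> deltoid"
        using r s that by (auto simp: z_def norm_mult)
      then have "deltoid_operator l f z + of_real \<mu> * f z = 0"
        using eig by simp
      moreover have "poly p (of_real s) = deltoid_operator l f z + of_real \<mu> * f z"
      proof -
        have f': "f = (\<lambda>z. \<Sum>i\<le>n. \<Sum>j\<le>n. a i j * z ^ i * cnj z ^ j)"
          using f by blast
        have "poly (smult (a i j) (m i j + t i j)) (of_real s) = a i j *
            (of_nat (i * (i - 1)) * z ^ (i - 2) * cnj z ^ (j + 1)
            + of_nat (i * j) * z ^ (i - 1) * cnj z ^ (j - 1)
            + of_nat (j * (j - 1)) * z ^ (i + 1) * cnj z ^ (j - 2)
            - of_real (deltoid_eigenvalue l i j) * z ^ i * cnj z ^ j)
          + of_real \<mu> * (a i j * z ^ i * cnj z ^ j)" for i j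
        proof -
          have z: "c * z ^ p * cnj z ^ q = poly (monom (c * u ^ p * cnj u ^ q) (p + q)) (of_real s)"
            for c p q
            by (simp add: z_def poly_monom power_mult_distrib power_add)
          have d: "monom (of_real (\<mu> - x) * y * w) k = smult (of_real \<mu>) (monom (y * w) k)
              - monom (of_real x * y * w) k" for x y w k
            by (simp add: smult_monom diff_monom algebra_simps)
          have "a i j * z ^ i * cnj z ^ j = a i j * poly (monom (u ^ i * cnj u ^ j) (i + j)) (of_real s)"
            using z[of 1 i j] by (simp only: mult_1_left mult.assoc)
          then show ?thesis
            unfolding z m_def t_def d poly_smult poly_add poly_diff by 
            (simp only: distrib_left right_diff_distrib diff_conv_add_uminus ac_simps)
        qed
        then show ?thesis
          unfolding f' deltoid_operator_sum_monomials p_def poly_sum sum_distrib_left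
            sum.distrib[symmetric] by (intro sum.cong refl) 
      qed
      ultimately show "poly p (of_real s) = 0" by simp
    qed
    \<comment> \<open>Only \<open>i + j = n\<close> contributes: larger total degrees have
      coefficient \<open>a i j = 0\<close>, and each summand of \<open>t i j\<close> is zero or of
      degree below \<open>n\<close>.\<close>
    have "a i j * coeff (m i j + t i j) n = (if j = n - i then c i * u ^ i * cnj u ^ (n - i) else 0)"
      if "i \<le> n" for i j
    proof (cases "n < i + j")
      case True
      with that show ?thesis using deg[OF True] by auto
    next
      case False
      have "coeff (t i j) n = 0"
      proof -
        have c: "coeff (monom (of_nat x * y * w) k) n = 0" if "x = 0 \<or> k < n" for x k and y w :: complex
          using that by auto
        have "i * (i - 1) = 0 \<or> i - 2 + (j + 1) < n" using False by (cases "i \<le> 1") auto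
        moreover have "i * j = 0 \<or> i - 1 + (j - 1) < n" using False by (cases "i = 0 \<or> j = 0") auto
        moreover have "j * (j - 1) = 0 \<or> i + 1 + (j - 2) < n" using False by (cases "j \<le> 1") auto
        ultimately show ?thesis by (simp only: t_def coeff_add c add_0)
      qed
      moreover have "j = n - i \<longleftrightarrow> i + j = n" using that False by auto
      ultimately show ?thesis by (auto simp: m_def c_def)
    qed
    then have "coeff p n = (\<Sum>i\<le>n. \<Sum>j\<le>n. if j = n - i then c i * u ^ i * cnj u ^ (n - i) else 0)"
      unfolding p_def coeff_sum coeff_smult by (intro sum.cong refl) simp
    also have "\<dots> = (\<Sum>i\<le>n. c i * u ^ i * cnj u ^ (n - i))"
      by (intro sum.cong refl) (simp add: sum.delta')
    finally show ?thesis using \<open>p = 0\<close> by simp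
  qed
  \<comment> \<open>Multiplying the relation by \<open>u ^ n\<close> turns
    \<open>u ^ i * cnj u ^ (n - i)\<close> into \<open>(u ^ 2) ^ i\<close>. Taking \<open>u\<close>
    to be a square root of an arbitrary unimodular \<open>w\<close> shows that \<open>q\<close>
    vanishes on the whole circle.\<close>
  define q where "q = (\<Sum>i\<le>n. monom (c i) i)"
  have "q = 0"
  proof (rule ccontr)
    assume "q \<noteq> 0"
    then have "finite {x. poly q x = 0}" by (rule poly_roots_finite)
    moreover have "sphere 0 1 \<subseteq> {x. poly q x = 0}"
    proof safe
      fix w :: complex assume w: "w \<in> sphere 0 1"
      define u where "u = csqrt w"
      have u: "u ^ 2 = w" "cmod u = 1" using w by (simp_all add: u_def norm_csqrt)
      have uu: "u * cnj u = 1" using u(2) by (simp add: complex_norm_square[symmetric])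
      have "u ^ n * (u ^ i * cnj u ^ (n - i)) = w ^ i" if "i \<le> n" for i
      proof -
        have "u ^ n = u ^ i * u ^ (n - i)" using that by (simp flip: power_add)
        then have "u ^ n * (u ^ i * cnj u ^ (n - i)) = (u ^ i * u ^ i) * (u * cnj u) ^ (n - i)"
          by (simp add: power_mult_distrib)
        also have "\<dots> = w ^ i" by (simp add: uu u(1)[symmetric] power2_eq_square power_mult_distrib)
        finally show ?thesis .
      qed
      then have "u ^ n * (\<Sum>i\<le>n. c i * u ^ i * cnj u ^ (n - i)) = (\<Sum>i\<le>n. c i * w ^ i)"
        unfolding sum_distrib_left by (intro sum.cong refl) (simp add: mult_ac)
      then show "poly q w = 0"
        using top[OF u(2)] by (simp add: q_def poly_sum poly_monom)
    qed
    ultimately have "finite (sphere (0::complex) 1)" by (rule rev_finite_subset)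
    moreover have "infinite (sphere (0::complex) 1)"
    proof -
      have "sphere (0::complex) 1 \<noteq> {c}" for c
      proof
        assume "sphere (0::complex) 1 = {c}"
        moreover have "1 \<in> sphere (0::complex) 1" "-1 \<in> sphere (0::complex) 1" by auto
        ultimately show False by (metis one_neq_neg_one singletonD)
      qed
      moreover have "connected (sphere (0::complex) 1)" by (rule connected_sphere) simp
      ultimately show ?thesis by (simp add: connected_finite_iff_sing)
    qed
    ultimately show False by simp
  qed
  then have "coeff q k = 0" by simp
  then have "c k = 0" using k(1) by (simp add: q_def coeff_sum)
  then show ?thesis using k(2) by (simp add: c_def)
qed

text \<open>The coefficient array is cut down to its support, so that \<open>n\<close> is the
  largest total degree with a nonzero coefficient; a pair attaining it determines the
  eigenvalue.\<close>

lemma polynomial_eigenvector_degree: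
  assumes "polynomial_eigenvector l \<mu> f" "\<mu> \<noteq> 0" "l \<ge> 1"
  shows "\<exists>n a. n \<ge> 1 \<and> real n ^ 2 \<le> 4 / 3 * \<mu> \<and>
    (\<forall>z. f z = (\<Sum>i\<le>n. \<Sum>j\<le>n. a i j * z ^ i * cnj z ^ j)) \<and>
    (\<forall>i j. n < i + j \<longrightarrow> a i j = 0)"
proof -
  have "polynomial_function f" using assms(1) by (simp add: polynomial_eigenvector_def)
  then obtain N a where a: "\<And>z. f z = (\<Sum>i\<le>N. \<Sum>j\<le>N. a i j * z ^ i * cnj z ^ j)"
    using polynomial_function_eq_sum by blast
  define S where "S = {(i, j). i \<le> N \<and> j \<le> N \<and> a i j \<noteq> 0}"
  define b where "b i j = (if (i, j) \<in> S then a i j else 0)" for i j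
  define n where "n = Max ((\<lambda>(i, j). i + j) ` S)"
  have "S \<subseteq> {..N} \<times> {..N}" by (auto simp: S_def)
  then have fin: "finite S" by (rule finite_subset) auto
  have "S \<noteq> {}"
  proof
    assume "S = {}"
    then have "f z = 0" for z by (auto simp: S_def a intro!: sum.neutral)
    then show False using assms(1) by (auto simp: polynomial_eigenvector_def)
  qed
  then have "n \<in> (\<lambda>(i, j). i + j) ` S"
    unfolding n_def using fin by (intro Max_in) auto
  then obtain k j where kj: "(k, j) \<in> S" "k + j = n" by auto
  have le: "i + j \<le> n" if "(i, j) \<in> S" for i j
    unfolding n_def using fin rev_image_eqI[OF that, of "i + j" "\<lambda>(i, j). i + j"]
    by (intro Max_ge) auto
  have b0: "b i j = 0" if "n < i + j" for i j
    using le that by (fastforce simp: b_def)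
  have fb: "f z = (\<Sum>i\<le>n. \<Sum>j\<le>n. b i j * z ^ i * cnj z ^ j)" for z
  proof -
    have "f z = (\<Sum>(i,j)\<in>{..N} \<times> {..N}. a i j * z ^ i * cnj z ^ j)"
      by (simp add: a sum.cartesian_product)
    also have "\<dots> = (\<Sum>(i,j)\<in>S. b i j * z ^ i * cnj z ^ j)"
      by (rule sum.mono_neutral_cong_right) (auto simp: S_def b_def)
    also have "\<dots> = (\<Sum>(i,j)\<in>{..n} \<times> {..n}. b i j * z ^ i * cnj z ^ j)"
      by (rule sum.mono_neutral_left) (auto simp: b_def dest: le)
    finally show ?thesis by (simp add: sum.cartesian_product)
  qed
  have \<mu>: "\<mu> = deltoid_eigenvalue l k (n - k)"
    by (rule eigenvalue_top_degree[OF fb b0])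
      (use assms(1) kj in \<open>auto simp: polynomial_eigenvector_def b_def S_def\<close>)
  then have \<mu>j: "\<mu> = deltoid_eigenvalue l k j" using kj by auto
  \<comment> \<open>For a constant polynomial the eigenvalue formula would give
    \<open>\<mu> = 0\<close>.\<close>
  have "n \<ge> 1" using \<mu>j kj assms(2) by (cases "n = 0") (auto simp: deltoid_eigenvalue_def)
  moreover have "real n ^ 2 \<le> 4 / 3 * \<mu>"
  proof -
    have *: "real (i * (i - 1)) = real i ^ 2 - real i" for i
      by (cases i) (auto simp: power2_eq_square algebra_simps)
    \<comment> \<open>The term \<open>l * (k + j)\<close> absorbs the negative linear terms of
      \<open>k * (k - 1) + j * (j - 1)\<close>.\<close>
    have "1 * real n \<le> l * real n" using assms(3) by (intro mult_right_mono) auto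
    then have "\<mu> \<ge> real k ^ 2 + real k * real j + real j ^ 2"
      unfolding \<mu>j deltoid_eigenvalue_def of_nat_add * kj(2)[symmetric] by simp
    \<comment> \<open>The quadratic form \<open>k ^ 2 + k * j + j ^ 2\<close> equals
      \<open>3/4 * (k + j) ^ 2 + 1/4 * (k - j) ^ 2\<close>.\<close>
    moreover have "0 \<le> (real k - real j) ^ 2" by simp
    ultimately show ?thesis by (simp add: kj(2)[symmetric] power2_eq_square algebra_simps)
  qed
  ultimately show ?thesis using fb b0 by (intro exI[of _ n] exI[of _ b]) simp
qed

section \<open>Weighted Nikolskii inequality on the circle\<close>

lemma has_integral_cis_period:
  "((\<lambda>t. cis (real_of_int k * t)) has_integral (if k = 0 then 2 * of_real pi else 0)) {0..2 * pi}"
proof (cases "k = 0")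
  case True
  then show ?thesis
    using has_integral_const_real[of "1 :: complex" 0 "2 * pi"] by (simp add: scaleR_conv_of_real)
next
  case False
  have "((\<lambda>t. cis (real_of_int k * t)) has_integral
      cis (real_of_int k * (2 * pi)) / (\<i> * of_int k) - cis (real_of_int k * 0) / (\<i> * of_int k)) {0..2 * pi}"
  proof (rule fundamental_theorem_of_calculus)
    fix t :: real
    have "((\<lambda>t. cis (real_of_int k * t) / (\<i> * of_int k)) has_vector_derivative
        (of_int k * (\<i> * cis (real_of_int k * t))) / (\<i> * of_int k)) (at t within {0..2 * pi})"
      by (auto intro!: derivative_eq_intros simp: has_vector_derivative_def scaleR_conv_of_real mult_ac)
    then show "((\<lambda>t. cis (real_of_int k * t) / (\<i> * of_int k)) has_vector_derivative
        cis (real_of_int k * t)) (at t within {0..2 * pi})"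
      using False by simp
  qed auto
  moreover have "cis (real_of_int k * (2 * pi)) = 1"
    by (metis cis_multiple_2pi Ints_of_int mult.commute)
  ultimately show ?thesis using False by simp
qed

lemma parseval_unit_circle:
  fixes p :: "complex poly"
  assumes "degree p \<le> m"
  shows "(LBINT t:{0..2*pi}. (cmod (poly p (cis t)))\<^sup>2) = 2 * pi * (\<Sum>i\<le>m. (cmod (coeff p i))\<^sup>2)"
proof -
  have poly: "poly p x = (\<Sum>i\<le>m. coeff p i * x ^ i)" for x
    unfolding poly_altdef
    by (rule sum.mono_neutral_left) (use assms in \<open>auto simp: coeff_eq_0\<close>)
  \<comment> \<open>The squared modulus is a double sum of characters
    \<open>cis ((i - j) * t)\<close>; integration over a period leaves the diagonal.\<close>
  have expand: "complex_of_real ((cmod (poly p (cis t)))\<^sup>2) =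
      (\<Sum>i\<le>m. \<Sum>j\<le>m. coeff p i * cnj (coeff p j) * cis (real_of_int (int i - int j) * t))" for t
  proof -
    have "complex_of_real ((cmod (poly p (cis t)))\<^sup>2) = poly p (cis t) * cnj (poly p (cis t))"
      by (rule complex_norm_square)
    also have "\<dots> = (\<Sum>i\<le>m. \<Sum>j\<le>m. (coeff p i * cis t ^ i) * cnj (coeff p j * cis t ^ j))"
      unfolding poly cnj_sum sum_product ..
    also have "\<dots> = (\<Sum>i\<le>m. \<Sum>j\<le>m. coeff p i * cnj (coeff p j) * cis (real_of_int (int i - int j) * t))"
      by (intro sum.cong refl) (simp add: Complex.DeMoivre cis_cnj left_diff_distrib cis_divide[symmetric]
          flip: cis_inverse, simp add: divide_inverse)
    finally show ?thesis .
  qed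
  have "((\<lambda>t. complex_of_real ((cmod (poly p (cis t)))\<^sup>2)) has_integral
      (\<Sum>i\<le>m. \<Sum>j\<le>m. coeff p i * cnj (coeff p j) * (if int i - int j = 0 then 2 * of_real pi else 0))) {0..2*pi}"
    unfolding expand
    by (intro has_integral_sum has_integral_mult_right has_integral_cis_period) auto
  also have "(\<Sum>i\<le>m. \<Sum>j\<le>m. coeff p i * cnj (coeff p j) * (if int i - int j = 0 then 2 * of_real pi else 0))
      = (\<Sum>i\<le>m. \<Sum>j\<le>m. if j = i then coeff p i * cnj (coeff p i) * (2 * of_real pi) else 0)"
    by (intro sum.cong refl) auto
  also have "\<dots> = complex_of_real (2 * pi * (\<Sum>i\<le>m. (cmod (coeff p i))\<^sup>2))"
    by (simp add: sum.delta' sum_distrib_left sum_distrib_right complex_norm_square[symmetric] mult_ac del: of_real_power)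
  finally have "((\<lambda>t. complex_of_real ((cmod (poly p (cis t)))\<^sup>2)) has_integral
      complex_of_real (2 * pi * (\<Sum>i\<le>m. (cmod (coeff p i))\<^sup>2))) {0..2*pi}" .
  from has_integral_linear[OF this bounded_linear_Re]
  have "((\<lambda>t. (cmod (poly p (cis t)))\<^sup>2) has_integral 2 * pi * (\<Sum>i\<le>m. (cmod (coeff p i))\<^sup>2)) {0..2*pi}"
    by (simp only: o_def Re_complex_of_real)
  then have "integral {0..2*pi} (\<lambda>t. (cmod (poly p (cis t)))\<^sup>2) = 2 * pi * (\<Sum>i\<le>m. (cmod (coeff p i))\<^sup>2)"
    by (rule integral_unique)
  moreover have "set_integrable lborel {0..2*pi} (\<lambda>t. (cmod (poly p (cis t)))\<^sup>2)"
    by (intro borel_integrable_atLeastAtMost' continuous_intros)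
  ultimately show ?thesis
    by (simp add: set_borel_integral_eq_integral)
qed

text \<open>On the unit circle the value is at most the sum of the moduli of the
  \<open>m + 1\<close> coefficients; Cauchy-Schwarz and Parseval then give the \<open>L2\<close>
  bound.\<close>

lemma nikolskii_unit_circle:
  fixes p :: "complex poly"
  assumes "degree p \<le> m" "cmod x = 1"
  shows "(cmod (poly p x))\<^sup>2 \<le> (real m + 1) / (2 * pi) * (LBINT t:{0..2*pi}. (cmod (poly p (cis t)))\<^sup>2)"
proof -
  have "poly p x = (\<Sum>i\<le>m. coeff p i * x ^ i)"
    unfolding poly_altdef
    by (rule sum.mono_neutral_left) (use assms in \<open>auto simp: coeff_eq_0\<close>)
  then have "cmod (poly p x) \<le> (\<Sum>i\<le>m. cmod (coeff p i))"
    using sum_norm_le[of "{..m}" "\<lambda>i. coeff p i * x ^ i" "\<lambda>i. cmod (coeff p i)"] assms(2)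
    by (simp add: norm_mult norm_power)
  then have "(cmod (poly p x))\<^sup>2 \<le> (\<Sum>i\<le>m. cmod (coeff p i) * 1)\<^sup>2"
    by (simp add: power_mono)
  also have "\<dots> \<le> (\<Sum>i\<le>m. (cmod (coeff p i))\<^sup>2) * (\<Sum>i\<le>m. 1\<^sup>2)"
    by (rule Cauchy_Schwarz_ineq_sum)
  also have "\<dots> = (real m + 1) / (2 * pi) * (2 * pi * (\<Sum>i\<le>m. (cmod (coeff p i))\<^sup>2))"
    using pi_gt_zero by (simp add: mult_ac add_ac)
  finally show ?thesis
    unfolding parseval_unit_circle[OF assms(1)] .
qed

section \<open>Short arcs and lower bounds for the weight\<close>

lemma third_le_sin:
  assumes "0 \<le> x" "x \<le> pi / 2"
  shows "x / 3 \<le> sin x"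
proof (cases "x \<le> pi / 3")
  case True
  \<comment> \<open>Up to \<open>pi / 3\<close> the cosine is at least 1/2, so the difference
    increases; beyond that, \<open>sin x\<close> exceeds 2/3 while
    \<open>x / 3 \<le> pi / 6 < 2/3\<close>.\<close>
  have "(\<lambda>x. sin x - x / 3) 0 \<le> (\<lambda>x. sin x - x / 3) x"
  proof (rule DERIV_nonneg_imp_nondecreasing[OF assms(1)])
    fix t assume t: "0 \<le> t" "t \<le> x"
    have "cos (pi / 3) \<le> cos t"
      using t True pi_gt_zero by (intro cos_monotone_0_pi_le) auto
    then show "\<exists>y. DERIV (\<lambda>x. sin x - x / 3) t :> y \<and> 0 \<le> y"
      by (intro exI[of _ "cos t - 1 / 3"]) (auto intro!: derivative_eq_intros simp: cos_60)
  qed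
  then show ?thesis by simp
next
  case False
  have "sin (pi / 3) \<le> sin x"
    using False assms pi_gt_zero by (intro sin_monotone_2pi_le) auto
  moreover have "2 / 3 \<le> sin (pi / 3)"
  proof -
    have "sqrt (16 / 9) \<le> sqrt 3" by (rule real_sqrt_le_mono) simp
    moreover have "sqrt (16 / 9) = (4 / 3 :: real)" by (simp add: real_sqrt_divide real_sqrt_eq_iff[symmetric])
    ultimately show ?thesis by (simp add: sin_60)
  qed
  ultimately show ?thesis using assms pi_less_4 by linarith
qed

lemma cmod_cis_diff: "cmod (cis s - cis t) = 2 * \<bar>sin ((s - t) / 2)\<bar>"
proof -
  have "(cmod (cis s - cis t))\<^sup>2 = 2 - 2 * cos (s - t)"
    using sin_cos_squared_add[of s] sin_cos_squared_add[of t]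
    unfolding cmod_power2 by (simp add: cos_diff power2_eq_square algebra_simps)
  also have "\<dots> = (2 * \<bar>sin ((s - t) / 2)\<bar>)\<^sup>2"
  proof -
    have "2 * ((s - t) / 2) = s - t" by simp
    then have "cos (s - t) = 1 - 2 * (sin ((s - t) / 2))\<^sup>2"
      using cos_double_sin[of "(s - t) / 2"] by (simp only:)
    then show ?thesis by (simp add: power_mult_distrib)
  qed
  finally show ?thesis by (rule power2_eq_imp_eq) auto
qed

text \<open>Besides the interval around the argument of \<open>a\<close>, the arc may wrap around at
  \<open>0\<close> or at \<open>2 * pi\<close>. The covering intervals have lengths
  \<open>6 * \<eta>\<close>, \<open>3 * \<eta>\<close> and \<open>3 * \<eta>\<close>.\<close>

lemma emeasure_arc_le:
  assumes a: "cmod a = 1" and "\<eta> > 0"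
  shows "emeasure lborel {t \<in> {0..2*pi}. cmod (cis t - a) < \<eta>} \<le> ennreal (12 * \<eta>)"
proof -
  define s where "s = Arg2pi a"
  have s: "0 \<le> s" "s \<le> 2 * pi" "a = cis s"
    using Arg2pi_ge_0[of a] Arg2pi_lt_2pi[of a] Arg2pi_eq[of a] a by (auto simp: s_def cis_conv_exp)
  have "{t \<in> {0..2*pi}. cmod (cis t - a) < \<eta>} \<subseteq>
     {s - 3 * \<eta>..s + 3 * \<eta>} \<union> ({0..3 * \<eta>} \<union> {2 * pi - 3 * \<eta>..2 * pi})"
  proof (rule subsetI, rule ccontr)
    fix t
    assume "t \<in> {t \<in> {0..2*pi}. cmod (cis t - a) < \<eta>}"
      and "t \<notin> {s - 3 * \<eta>..s + 3 * \<eta>} \<union> ({0..3 * \<eta>} \<union> {2 * pi - 3 * \<eta>..2 * pi})"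
    then have t: "t \<in> {0..2*pi}" "cmod (cis t - a) < \<eta>" "t \<notin> {0..3 * \<eta>}"
      "t \<notin> {2 * pi - 3 * \<eta>..2 * pi}" "t \<notin> {s - 3 * \<eta>..s + 3 * \<eta>}" by auto
    define d where "d = \<bar>t - s\<bar> / 2"
    have d: "0 \<le> d" "d \<le> pi" "2 * sin d < \<eta>"
    proof -
      have "d = (t - s) / 2 \<or> d = - ((t - s) / 2)" unfolding d_def by linarith
      then have "\<bar>sin ((t - s) / 2)\<bar> = \<bar>sin d\<bar>" by (metis abs_minus_cancel sin_minus)
      moreover show "0 \<le> d" "d \<le> pi" using t s by (auto simp: d_def)
      ultimately show "2 * sin d < \<eta>" using t(2) s(3) by (simp add: cmod_cis_diff)
    qed
    \<comment> \<open>A half-angle \<open>d\<close> beyond \<open>pi / 2\<close> is replaced by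
      \<open>pi - d\<close>: then \<open>\<bar>t - s\<bar>\<close> is close to
      \<open>2 * pi\<close>, which puts \<open>t\<close> near an endpoint, and this was
      excluded.\<close>
    have "d \<le> 3 / 2 * \<eta>"
    proof (cases "d \<le> pi / 2")
      case True
      then show ?thesis using third_le_sin[of d] d by simp
    next
      case False
      then have "(pi - d) / 3 \<le> sin (pi - d)" using d by (intro third_le_sin) auto
      then have "2 * pi - 3 * \<eta> \<le> \<bar>t - s\<bar>" using d(3) by (simp add: d_def)
      then show ?thesis using t s assms(2) by auto
    qed
    then show False using t(5) by (auto simp: d_def)
  qed
  then have "emeasure lborel {t \<in> {0..2*pi}. cmod (cis t - a) < \<eta>} \<le>
    emeasure lborel ({s - 3 * \<eta>..s + 3 * \<eta>} \<union> ({0..3 * \<eta>} \<union> {2 * pi - 3 * \<eta>..2 * pi}))"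
    by (rule emeasure_mono) auto
  also have "\<dots> \<le> emeasure lborel {s - 3 * \<eta>..s + 3 * \<eta>} +
     (emeasure lborel {0..3 * \<eta>} + emeasure lborel {2 * pi - 3 * \<eta>..2 * pi})"
    by (intro order_trans[OF emeasure_subadditive] add_left_mono) auto
  also have "\<dots> = ennreal (12 * \<eta>)"
    using assms(2) by (simp flip: ennreal_plus)
  finally show ?thesis .
qed

definition deltoid_weight :: "real \<Rightarrow> real \<Rightarrow> real" where
  "deltoid_weight u v = \<bar>sin v * (cos v - cos (3 * u))\<bar>"

text \<open>With \<open>x = cis v\<close>, both \<open>2 * \<i> * sin v * x\<close> and
  \<open>2 * (cos v - cos (3 * u)) * x\<close> are monic quadratics in \<open>x\<close>, with roots
  \<open>1, -1\<close> and \<open>cis (3 * u), cis (- (3 * u))\<close>.\<close>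

lemma deltoid_weight_eq:
  "deltoid_weight u v = cmod (cis v - 1) * cmod (cis v + 1) *
     (cmod (cis v - cis (3 * u)) * cmod (cis v - cis (- (3 * u)))) / 4"
proof -
  have "(cis v - 1) * (cis v + 1) = 2 * \<i> * of_real (sin v) * cis v"
    using sin_cos_squared_add[of v]
    by (simp add: complex_eq_iff algebra_simps power2_eq_square)
  then have 1: "cmod (cis v - 1) * cmod (cis v + 1) = 2 * \<bar>sin v\<bar>"
    by (metis (no_types, lifting) norm_mult norm_cis norm_ii norm_of_real norm_numeral mult.right_neutral)
  have "(cis v - cis (3 * u)) * (cis v - cis (- (3 * u))) = 2 * of_real (cos v - cos (3 * u)) * cis v"
    using sin_cos_squared_add[of v] sin_cos_squared_add[of "3 * u"]
    by (simp add: complex_eq_iff algebra_simps power2_eq_square)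
  then have 2: "cmod (cis v - cis (3 * u)) * cmod (cis v - cis (- (3 * u))) = 2 * \<bar>cos v - cos (3 * u)\<bar>"
    by (metis (no_types, lifting) norm_mult norm_cis norm_of_real norm_numeral mult.right_neutral)
  show ?thesis
    unfolding 1 2 deltoid_weight_def by (simp add: abs_mult)
qed

text \<open>The points 1 and -1 are at distance 2, so one of these two factors is at least 1. Hence
  at most three of the four factors are small, and the bound is cubic in \<open>\<eta>\<close>; this
  determines the final power of the degree.\<close>

lemma deltoid_weight_ge:
  assumes "\<And>a. a \<in> {1, -1, cis (3 * u), cis (- (3 * u))} \<Longrightarrow> \<eta> \<le> cmod (cis v - a)" "0 < \<eta>"
  shows "\<eta> ^ 3 / 4 \<le> deltoid_weight u v"
proof -
  have "2 \<le> cmod (cis v - 1) + cmod (cis v + 1)"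
    using norm_triangle_ineq[of "cis v + 1" "1 - cis v"] by (simp add: norm_minus_commute)
  then consider "1 \<le> cmod (cis v - 1)" | "1 \<le> cmod (cis v + 1)" by linarith
  then have "\<eta> \<le> cmod (cis v - 1) * cmod (cis v + 1)"
  proof cases
    case 1
    then show ?thesis using assms(1)[of "-1"] assms(2) mult_mono[OF 1, of \<eta> "cmod (cis v + 1)"] by auto
  next
    case 2
    then show ?thesis using assms(1)[of "1"] assms(2) mult_mono[OF _ 2, of \<eta> "cmod (cis v - 1)"] by auto
  qed
  moreover have "\<eta> * \<eta> \<le> cmod (cis v - cis (3 * u)) * cmod (cis v - cis (- (3 * u)))"
    using assms(1)[of "cis (3 * u)"] assms(1)[of "cis (- (3 * u))"] assms(2)
    by (intro mult_mono) simp_all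
  ultimately have "\<eta> * (\<eta> * \<eta>) \<le> cmod (cis v - 1) * cmod (cis v + 1) *
     (cmod (cis v - cis (3 * u)) * cmod (cis v - cis (- (3 * u))))"
    using assms(2) by (intro mult_mono[of \<eta> _ "\<eta> * \<eta>"]) auto
  then show ?thesis unfolding deltoid_weight_eq by (simp add: power3_eq_cube)
qed

lemma deltoid_weight_nonneg: "0 \<le> deltoid_weight u v"
  by (simp add: deltoid_weight_def)

lemma deltoid_weight_le_2: "deltoid_weight u v \<le> 2"
proof -
  have "\<bar>sin v\<bar> * \<bar>cos v - cos (3 * u)\<bar> \<le> 1 * 2"
    using abs_sin_le_one[of v] abs_cos_le_one[of v] abs_cos_le_one[of "3 * u"]
    by (intro mult_mono) linarith+
  then show ?thesis by (simp add: deltoid_weight_def abs_mult)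
qed

text \<open>By the unweighted inequality, the short arcs around the four zeros of the weight carry
  at most half of the mass of \<open>S\<close>. The rest lies where the weight is at least
  \<open>\<eta> ^ 3 / 4\<close>.\<close>

lemma weighted_nikolskii:
  fixes p :: "complex poly"
  assumes "degree p \<le> m" "cmod x = 1" "b \<ge> 0"
  shows "(cmod (poly p x))\<^sup>2 \<le> (real m + 1) * (16384 * (real m + 1) ^ 3) powr b *
    (LBINT t:{0..2*pi}. (cmod (poly p (cis t)))\<^sup>2 * deltoid_weight u t powr b)"
proof -
  define S where "S t = (cmod (poly p (cis t)))\<^sup>2" for t
  \<comment> \<open>The choice makes \<open>48 * \<eta> * (m + 1) / (2 * pi)\<close> equal to
    \<open>3 / (2 * pi)\<close>, which is at most 1/2.\<close>
  define \<eta> where "\<eta> = 1 / (16 * (real m + 1))"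
  have \<eta>: "\<eta> > 0" by (simp add: \<eta>_def)
  define A where "A = {1, -1, cis (3 * u), cis (- (3 * u))}"
  have finA: "finite A" by (simp add: A_def)
  define E where "E = {t \<in> {0..2*pi}. \<exists>a\<in>A. cmod (cis t - a) < \<eta>}"
  define M where "M = (LBINT t:{0..2*pi}. S t)"
  have arc[measurable]: "{t \<in> {0..2*pi}. cmod (cis t - a) < \<eta>} \<in> sets lborel" for a
    unfolding cis_conv_exp by measurable
  have E_eq: "E = (\<Union>a\<in>A. {t \<in> {0..2*pi}. cmod (cis t - a) < \<eta>})"
    by (auto simp: E_def)
  have Em[measurable]: "E \<in> sets lborel"
    unfolding E_eq by (intro sets.finite_UN arc finA)
  have S_int: "set_integrable lborel {0..2*pi} S"
    unfolding S_def by (intro borel_integrable_atLeastAtMost' continuous_intros)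
  have S_nonneg: "0 \<le> S t" for t by (simp add: S_def)
  have "emeasure lborel E \<le> (\<Sum>a\<in>A. emeasure lborel {t \<in> {0..2*pi}. cmod (cis t - a) < \<eta>})"
    unfolding E_eq by (intro emeasure_subadditive_finite finA image_subsetI arc)
  also have "\<dots> \<le> (\<Sum>a\<in>A. ennreal (12 * \<eta>))"
    by (intro sum_mono emeasure_arc_le \<eta>) (auto simp: A_def)
  also have "\<dots> = of_nat (card A) * ennreal (12 * \<eta>)"
    by simp
  also have "\<dots> \<le> 4 * ennreal (12 * \<eta>)"
  proof -
    \<comment> \<open>For some \<open>u\<close> the four zeros coincide in part, so only an upper
      bound on their number is available.\<close>
    have "card A \<le> 4" unfolding A_def by (simp add: card_insert_if)
    then have "of_nat (card A) \<le> (of_nat 4 :: ennreal)" by (simp only: of_nat_le_iff)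
    then show ?thesis by (intro mult_right_mono) auto
  qed
  also have "\<dots> = ennreal (48 * \<eta>)"
    using \<eta> by (simp flip: ennreal_numeral ennreal_mult)
  finally have emE: "emeasure lborel E \<le> ennreal (48 * \<eta>)" .
  then have mE: "measure lborel E \<le> 48 * \<eta>"
    unfolding measure_def using \<eta> enn2real_mono[OF emE] by simp
  have finE: "emeasure lborel E < \<infinity>"
    using emE by (rule order_le_less_trans) simp
  have M_nonneg: "0 \<le> M"
    unfolding M_def set_lebesgue_integral_def by (intro integral_nonneg_AE) (auto simp: S_nonneg)
  have nik: "S t \<le> (real m + 1) / (2 * pi) * M" for t
    unfolding S_def M_def by (rule nikolskii_unit_circle[OF assms(1)]) simp
  have SE_int: "set_integrable lborel E S"
    by (rule set_integrable_subset[OF S_int Em]) (auto simp: E_def)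
  have "(LBINT t:E. S t) \<le> (LBINT t:E. (real m + 1) / (2 * pi) * M)"
  proof (rule set_integral_mono[OF SE_int _ nik])
    show "set_integrable lborel E (\<lambda>t. (real m + 1) / (2 * pi) * M)"
      unfolding set_integrable_def using finE Em
      by (intro integrable_scaleR_left integrable_real_indicator) auto
  qed
  also have "\<dots> = measure lborel E * ((real m + 1) / (2 * pi) * M)"
    using finE by (simp add: set_lebesgue_integral_def)
  also have "\<dots> \<le> 48 * \<eta> * ((real m + 1) / (2 * pi) * M)"
    using mE M_nonneg by (intro mult_right_mono) auto
  also have "\<dots> = 3 / (2 * pi) * M"
  proof -
    have "48 * \<eta> * ((real m + 1) / (2 * pi) * M) = 3 * (16 * (real m + 1) * \<eta>) / (2 * pi) * M"
      by (simp add: field_simps)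
    moreover have "16 * (real m + 1) * \<eta> = 1" by (simp add: \<eta>_def)
    ultimately show ?thesis by simp
  qed
  also have "\<dots> \<le> 1 / 2 * M"
    using pi_gt3 M_nonneg by (intro mult_right_mono) (auto simp: field_simps)
  finally have half: "(LBINT t:E. S t) \<le> M / 2" by simp
  have Dm: "{0..2*pi} - E \<in> sets lborel" by (intro sets.Diff Em) simp
  have SD_int: "set_integrable lborel ({0..2*pi} - E) S"
    by (rule set_integrable_subset[OF S_int Dm]) auto
  have M_split: "M = (LBINT t:E. S t) + (LBINT t:{0..2*pi} - E. S t)"
  proof -
    have "{0..2*pi} = E \<union> ({0..2*pi} - E)" by (auto simp: E_def)
    moreover have "(LBINT t:E \<union> ({0..2*pi} - E). S t) = (LBINT t:E. S t) + (LBINT t:{0..2*pi} - E. S t)"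
      by (rule set_integral_Un) (simp_all add: SE_int SD_int)
    ultimately show ?thesis unfolding M_def by simp
  qed
  \<comment> \<open>Since \<open>4 * 16 ^ 3 = 16384\<close>, this is the reciprocal of
    \<open>16384 * (m + 1) ^ 3\<close>.\<close>
  define \<epsilon> where "\<epsilon> = \<eta> ^ 3 / 4"
  have \<epsilon>: "\<epsilon> > 0" using \<eta> by (simp add: \<epsilon>_def)
  have wm[measurable]: "(\<lambda>t. deltoid_weight u t) \<in> borel_measurable borel"
    unfolding deltoid_weight_def by measurable
  have Sm[measurable]: "S \<in> borel_measurable borel"
    unfolding S_def by (intro borel_measurable_continuous_onI continuous_intros)
  have wS_int: "set_integrable lborel {0..2*pi} (\<lambda>t. S t * deltoid_weight u t powr b)"
    unfolding set_integrable_def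
  proof (rule Bochner_Integration.integrable_bound)
    show "integrable lborel (\<lambda>t. 2 powr b * (indicator {0..2*pi} t *\<^sub>R S t))"
      using S_int unfolding set_integrable_def by (rule integrable_mult_right)
    have "S t * deltoid_weight u t powr b \<le> 2 powr b * S t" for t
      using mult_right_mono[OF powr_mono2[OF assms(3) deltoid_weight_nonneg deltoid_weight_le_2] S_nonneg]
      by (simp add: mult_ac)
    then show "AE t in lborel. norm (indicator {0..2*pi} t *\<^sub>R (S t * deltoid_weight u t powr b))
        \<le> norm (2 powr b * (indicator {0..2*pi} t *\<^sub>R S t))"
      by (intro AE_I2) (auto simp: indicator_def S_nonneg abs_mult)
  qed measurable
  have "M / 2 * \<epsilon> powr b \<le> (LBINT t:{0..2*pi} - E. S t) * \<epsilon> powr b"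
    using M_split half by (intro mult_right_mono) auto
  also have "\<dots> = (LBINT t:{0..2*pi} - E. S t * \<epsilon> powr b)"
    by simp
  also have "\<dots> \<le> (LBINT t:{0..2*pi} - E. S t * deltoid_weight u t powr b)"
  proof (rule set_integral_mono)
    show "set_integrable lborel ({0..2 * pi} - E) (\<lambda>t. S t * \<epsilon> powr b)"
      by (intro set_integrable_mult_left SD_int)
    show "set_integrable lborel ({0..2 * pi} - E) (\<lambda>t. S t * deltoid_weight u t powr b)"
      by (rule set_integrable_subset[OF wS_int Dm]) auto
    fix t assume "t \<in> {0..2 * pi} - E"
    then have "\<epsilon> \<le> deltoid_weight u t"
      unfolding \<epsilon>_def by (intro deltoid_weight_ge \<eta>) (fastforce simp: E_def A_def)
    then show "S t * \<epsilon> powr b \<le> S t * deltoid_weight u t powr b"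
      using \<epsilon> assms(3) by (intro mult_left_mono powr_mono2 S_nonneg) auto
  qed
  also have "\<dots> \<le> (LBINT t:{0..2*pi}. S t * deltoid_weight u t powr b)"
    unfolding set_lebesgue_integral_def
  proof (rule integral_mono)
    show "integrable lborel (\<lambda>t. indicator ({0..2 * pi} - E) t *\<^sub>R (S t * deltoid_weight u t powr b))"
      using set_integrable_subset[OF wS_int Dm] by (simp add: set_integrable_def)
    show "integrable lborel (\<lambda>t. indicator {0..2 * pi} t *\<^sub>R (S t * deltoid_weight u t powr b))"
      using wS_int by (simp add: set_integrable_def)
  qed (auto simp: indicator_def S_nonneg)
  finally have main: "M / 2 * \<epsilon> powr b \<le> (LBINT t:{0..2*pi}. S t * deltoid_weight u t powr b)" .
  have \<epsilon>': "(16384 * (real m + 1) ^ 3) powr b * \<epsilon> powr b = 1"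
  proof -
    have "16384 * x ^ 3 * ((1 / (16 * x)) ^ 3 / 4) = 1" if "x > 0" for x :: real
      using that by (simp add: power_divide power_mult_distrib)
    from this[of "real m + 1"] have "16384 * (real m + 1) ^ 3 * \<epsilon> = 1"
      unfolding \<epsilon>_def \<eta>_def by simp
    then show ?thesis using \<epsilon> by (simp flip: powr_mult)
  qed
  have "(cmod (poly p x))\<^sup>2 \<le> (real m + 1) / (2 * pi) * M"
    unfolding S_def M_def by (rule nikolskii_unit_circle[OF assms(1,2)])
  also have "\<dots> \<le> (real m + 1) * (M / 2)"
  proof -
    have "M / pi \<le> M"
      using pi_gt3 M_nonneg mult_right_mono[of 1 pi M] by (simp add: pos_divide_le_eq mult.commute)
    then have "(real m + 1) * (M / pi / 2) \<le> (real m + 1) * (M / 2)"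
      by (intro mult_left_mono) auto
    then show ?thesis by (simp add: mult.commute)
  qed
  also have "\<dots> = (real m + 1) * (16384 * (real m + 1) ^ 3) powr b * (M / 2 * \<epsilon> powr b)"
    using \<epsilon>' by (simp add: mult_ac)
  also have "\<dots> \<le> (real m + 1) * (16384 * (real m + 1) ^ 3) powr b *
      (LBINT t:{0..2*pi}. S t * deltoid_weight u t powr b)"
    by (intro mult_left_mono main) auto
  finally show ?thesis unfolding S_def .
qed

section \<open>The deltoid as a quotient of the torus\<close>

lemma P0_eq: "P0 z = 1 / 4 - 3 / 2 * (cmod z)\<^sup>2 + 2 * Re (z ^ 3) - 3 / 4 * (cmod z) ^ 4"
proof -
  have "(cmod z) ^ 4 = ((cmod z)\<^sup>2)\<^sup>2" by simp
  then show ?thesis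
    unfolding P0_def cmod_power2 
    by (simp add: power2_eq_square power3_eq_cube field_simps)
qed

text \<open>This makes the set where \<open>P0\<close> is positive star-shaped, hence connected.\<close>

lemma P0_ray_antimono:
  assumes "0 \<le> s" "s \<le> 1"
  shows "P0 z \<le> P0 (of_real s * z)"
proof -
  define r R where "r = cmod z" and "R = Re (z ^ 3)"
  have R: "R \<le> r ^ 3"
    using complex_Re_le_cmod[of "z ^ 3"] by (simp add: r_def R_def norm_power)
  define g where "g t = 1 / 4 - 3 / 2 * (t\<^sup>2 * r\<^sup>2) + 2 * (t ^ 3 * R) - 3 / 4 * (t ^ 4 * r ^ 4)" for t :: real
  have g: "P0 (of_real t * z) = g t" for t
  proof -
    have "Re ((of_real t * z) ^ 3) = t ^ 3 * R"
      by (simp add: R_def power_mult_distrib flip: of_real_power)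
    then show ?thesis
      unfolding P0_eq g_def by (simp add: norm_mult power_mult_distrib r_def)
  qed
  have "g 1 \<le> g s"
  proof (rule DERIV_nonpos_imp_nonincreasing[OF assms(2)])
    fix t assume t: "s \<le> t" "t \<le> 1"
    \<comment> \<open>Replacing \<open>R\<close> by its upper bound \<open>r ^ 3\<close> turns the
      derivative of \<open>g\<close> into \<open>- 3 * t * r ^ 2 * (1 - t * r) ^ 2\<close>.\<close>
    have "t ^ 2 * R \<le> t ^ 2 * r ^ 3" using R by (intro mult_left_mono) auto
    moreover have "0 \<le> t * r\<^sup>2 * (1 - t * r)\<^sup>2" using t assms by simp
    ultimately have "- 3 * t * r\<^sup>2 + 6 * t\<^sup>2 * R - 3 * t ^ 3 * r ^ 4 \<le> 0"
      by (simp add: power2_eq_square power3_eq_cube power4_eq_xxxx algebra_simps)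
    moreover have "DERIV g t :> - 3 * t * r\<^sup>2 + 6 * t\<^sup>2 * R - 3 * t ^ 3 * r ^ 4"
      unfolding g_def by (auto intro!: derivative_eq_intros)
    ultimately show "\<exists>y. DERIV g t :> y \<and> y \<le> 0" by blast
  qed
  then show ?thesis using g[of 1] g[of s] by simp
qed

text \<open>This is the mean of the three unimodular numbers \<open>cis (- 2 * u)\<close>,
  \<open>cis (u + v)\<close>, \<open>cis (u - v)\<close> of product 1, that is, a third of the trace
  on the diagonal torus of SU(3).\<close>

definition deltoid_map :: "real \<Rightarrow> real \<Rightarrow> complex" where
  "deltoid_map u v = (cis (- 2 * u) + 2 * of_real (cos v) * cis u) / 3"

lemma cos_triple: "cos (3 * u) = 4 * cos u ^ 3 - 3 * cos (u::real)"
  using cos_treble_cos[of u] by simp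

text \<open>Here \<open>k\<close> generalises \<open>cos v\<close> to an arbitrary real, so that
  points outside the domain are covered too. Up to a constant factor \<open>P0\<close> is the
  discriminant of the cubic whose roots appear in \<open>deltoid_map_roots\<close>, which explains
  the factors.\<close>

lemma P0_cubic_param:
  "P0 ((cis (- 2 * u) + 2 * of_real k * cis u) / 3) = 4 / 27 * (1 - k\<^sup>2) * (k - cos (3 * u))\<^sup>2"
proof -
  define c s where "c = cos u" and "s = sin u"
  define z where "z = (cis (- 2 * u) + 2 * of_real k * cis u) / 3"
  have s2: "s\<^sup>2 = 1 - c\<^sup>2" by (simp add: c_def s_def sin_squared_eq)
  have x: "Re z = (2 * c\<^sup>2 - 1 + 2 * k * c) / 3"
    by (simp add: z_def c_def cos_double_cos)
  have y: "Im z = 2 * s * (k - c) / 3"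
    by (simp add: z_def c_def s_def sin_double) (simp add: field_simps)
  have y2: "(Im z)\<^sup>2 = 4 * (1 - c\<^sup>2) * (k - c)\<^sup>2 / 9"
    by (simp add: y power_mult_distrib power_divide s2)
  have C: "cos (3 * u) = 4 * c ^ 3 - 3 * c" by (simp add: c_def cos_triple)
  have "(cmod z)\<^sup>2 = (1 + 4 * k\<^sup>2 + 4 * k * cos (3 * u)) / 9"
    unfolding cmod_power2 y2 x C
    by (simp add: power2_eq_square power3_eq_cube field_simps)
  moreover have "Re (z ^ 3) = (2 * (cos (3 * u))\<^sup>2 - 1 + 6 * k * cos (3 * u) + 12 * k\<^sup>2 + 8 * k ^ 3 * cos (3 * u)) / 27"
  proof -
    have "Re (z ^ 3) = Re z * ((Re z)\<^sup>2 - 3 * (Im z)\<^sup>2)"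
      by (simp add: power3_eq_cube power2_eq_square algebra_simps)
    then show ?thesis
      unfolding y2 x C by (simp add: power2_eq_square power3_eq_cube field_simps)
  qed
  moreover have "(cmod z) ^ 4 = ((cmod z)\<^sup>2)\<^sup>2" by simp
  ultimately have "P0 z = 4 / 27 * (1 - k\<^sup>2) * (k - cos (3 * u))\<^sup>2"
    unfolding P0_eq by (simp only:) (simp add: power2_eq_square power3_eq_cube field_simps)
  then show ?thesis unfolding z_def .
qed

lemma P0_deltoid_map: "P0 (deltoid_map u v) = 4 / 27 * (deltoid_weight u v)\<^sup>2"
  unfolding deltoid_map_def P0_cubic_param deltoid_weight_def
  by (simp add: power_mult_distrib sin_squared_eq)

text \<open>
  The numbers \<open>exp (\<i> \<theta>)\<close> with \<open>\<theta> = -2u\<close> are the unimodular roots of \<open>X\<^sup>3 - 3 z X\<^sup>2 + 3 (cnj z) X - 1\<close>. One of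
  them always exists because \<open>sin 3s - 3 Im (z exp (\<i> s))\<close>, \<open>s = \<theta>/2\<close>, changes sign under \<open>s \<mapsto> s + \<pi>\<close>;
  real \<open>k\<close> with \<open>\<bar>k\<bar> \<le> 1\<close> correspond to all three roots being unimodular.
\<close>

lemma cubic_param_surj:
  obtains u k where "0 \<le> u" "u < 2 * pi" "z = (cis (- 2 * u) + 2 * of_real k * cis u) / 3"
proof -
  define h where "h s = sin (3 * s) - 3 * Im (z * cis s)" for s
  have h_pi: "h pi = - h 0"
    using sin_npi[of 3] by (simp add: h_def mult.commute)
  have cont: "continuous_on {0..pi} h" unfolding h_def by (intro continuous_intros)
  have "\<exists>s. 0 \<le> s \<and> s \<le> pi \<and> h s = 0"
  proof (cases "h 0 \<le> 0")
    case True
    then show ?thesis using IVT'[of h 0 0 pi] cont h_pi by auto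
  next
    case False
    then show ?thesis using IVT2'[of h pi 0 0] cont h_pi by auto
  qed
  then obtain s where s: "0 \<le> s" "s \<le> pi" "h s = 0" by blast
  \<comment> \<open>The equation \<open>h s = 0\<close> says that \<open>w\<close> is real; solving
    for \<open>z\<close> gives the required form with \<open>u = - s\<close> and
    \<open>k = w / 2\<close>.\<close>
  define w where "w = 3 * z * cis s - cis (3 * s)"
  have "Im w = 0" using s(3) by (simp add: w_def h_def)
  then have w: "w = of_real (Re w)" by (simp add: complex_eq_iff)
  have "3 * z = (w + cis (3 * s)) * cis (- s)"
    by (simp add: w_def cis_mult)
  also have "\<dots> = cis (2 * s) + w * cis (- s)"
    by (simp add: distrib_right cis_mult)
  finally have z: "z = (cis (2 * s) + 2 * of_real (Re w / 2) * cis (- s)) / 3"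
    using w by (simp add: field_simps)
  show ?thesis
  \<comment> \<open>The parameter \<open>- s\<close> is shifted by \<open>2 * pi\<close> into the
    half-open range, except for \<open>s = 0\<close>, which would reach the excluded
    endpoint.\<close>
  proof (cases "s = 0")
    case True
    then show ?thesis using that[of 0 "Re w / 2"] z pi_gt_zero by simp
  next
    case False
    have "cis (- 2 * (2 * pi - s)) = cis (2 * s)"
    proof -
      have "- 2 * (2 * pi - s) = 2 * s - 2 * pi - 2 * pi" by simp
      then show ?thesis by (simp only: cis_divide[symmetric] cis_2pi div_by_1)
    qed
    moreover have "cis (2 * pi - s) = cis (- s)"
      by (simp add: complex_eq_iff cos_diff sin_diff)
    ultimately show ?thesis using that[of "2 * pi - s" "Re w / 2"] z False s by simp
  qed
qed

text \<open>A zero of \<open>P0\<close> is a double root of the cubic, and the curve parameter is an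
  argument of that root: \<open>u\<close> for \<open>k = 1\<close>, \<open>u + pi\<close> for
  \<open>k = -1\<close>, and \<open>- 2 * u\<close> for \<open>k = cos (3 * u)\<close>.\<close>

lemma P0_eq_0_imp_curve:
  assumes "P0 z = 0"
  shows "z \<in> range deltoid_curve"
proof -
  obtain u k where z: "z = (cis (- 2 * u) + 2 * of_real k * cis u) / 3"
    by (rule cubic_param_surj)
  have "(1 - k\<^sup>2) * (k - cos (3 * u))\<^sup>2 = 0"
    using assms unfolding z P0_cubic_param by simp
  then have "k = 1 \<or> k = -1 \<or> k = cos (3 * u)"
    by (auto simp: power2_eq_1_iff)
  then consider "k = 1" | "k = -1" | "k = cos (3 * u)" by blast
  then show ?thesis
  proof cases
    case 1
    then have "z = deltoid_curve u" by (simp add: z deltoid_curve_cis)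
    then show ?thesis by blast
  next
    case 2
    have "cis (u + pi) = - cis u" by (simp add: cis_mult[symmetric])
    moreover have "cis (- 2 * (u + pi)) = cis (- 2 * u)"
    proof -
      have "- 2 * (u + pi) = - 2 * u - 2 * pi" by simp
      then show ?thesis by (simp only: cis_divide[symmetric] cis_2pi div_by_1)
    qed
    ultimately have "z = deltoid_curve (u + pi)"
      unfolding deltoid_curve_cis z 2 by simp
    then show ?thesis by blast
  next
    case 3
    have "2 * of_real (cos (3 * u)) * cis u = (cis (3 * u) + cis (- (3 * u))) * cis u"
      by (simp add: complex_eq_iff)
    also have "\<dots> = cis (4 * u) + cis (- 2 * u)"
      by (simp add: distrib_right cis_mult)
    finally have "z = deltoid_curve (- 2 * u)"
      unfolding deltoid_curve_cis z 3 by simp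
    then show ?thesis by blast
  qed
qed

lemma continuous_on_P0 [continuous_intros]: "continuous_on A P0"
  unfolding P0_def by (intro continuous_intros) auto

text \<open>The positivity set is connected, contains 0 and avoids the curve, so it lies in the
  component. Conversely, a point of the component with \<open>P0 \<le> 0\<close> would produce a
  zero of \<open>P0\<close> there, and all such zeros lie on the curve.\<close>

lemma deltoid_eq: "deltoid = {z. 0 < P0 z}"
proof
  have zero: "0 < P0 0" by (simp add: P0_def)
  show "{z. 0 < P0 z} \<subseteq> deltoid"
    unfolding deltoid_def
  proof (rule connected_component_maximal)
    have "starlike {z. 0 < P0 z}"
      unfolding starlike_def
    proof (intro bexI[of _ 0] ballI subsetI)
      fix z w assume z: "z \<in> {z. 0 < P0 z}" and w: "w \<in> closed_segment 0 z"
      then obtain s where "0 \<le> s" "s \<le> 1" "w = of_real s * z"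
        by (auto simp: in_segment scaleR_conv_of_real)
      then show "w \<in> {z. 0 < P0 z}"
        using P0_ray_antimono[of s z] z by auto
    qed (use zero in simp)
    then show "connected {z. 0 < P0 z}" by (rule starlike_imp_connected)
    have "P0 (deltoid_curve t) = 0" for t
      using P0_cubic_param[of t 1] by (simp add: deltoid_curve_cis add.commute)
    then show "{z. 0 < P0 z} \<subseteq> - range deltoid_curve" by auto
  qed (use zero in simp)
  show "deltoid \<subseteq> {z. 0 < P0 z}"
  proof (rule subsetI, rule ccontr)
    fix z assume z: "z \<in> deltoid" "z \<notin> {z. 0 < P0 z}"
    have "connected (P0 ` deltoid)"
      by (intro connected_continuous_image continuous_intros) (simp add: deltoid_def)
    moreover have "P0 z \<in> P0 ` deltoid" "P0 0 \<in> P0 ` deltoid" using z zero_in_deltoid by auto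
    ultimately have "0 \<in> P0 ` deltoid"
      using z zero connected_contains_Icc[of "P0 ` deltoid" "P0 z" "P0 0"] by auto
    then obtain w where "w \<in> deltoid" "P0 w = 0" by (metis imageE)
    then show False
      using P0_eq_0_imp_curve connected_component_subset unfolding deltoid_def by blast
  qed
qed

lemma deltoid_map_surj:
  assumes "z \<in> deltoid"
  obtains u v where "0 \<le> u" "u < 2 * pi" "0 < v" "v < pi" "z = deltoid_map u v"
proof -
  obtain u k where u: "0 \<le> u" "u < 2 * pi" and z: "z = (cis (- 2 * u) + 2 * of_real k * cis u) / 3"
    by (rule cubic_param_surj)
  \<comment> \<open>Positivity of \<open>P0\<close> forces \<open>\<bar>k\<bar> < 1\<close>, so that
    \<open>k\<close> is the cosine of some \<open>v\<close> in the open interval from 0 to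
    \<open>pi\<close>.\<close>
  have "0 < 4 / 27 * (1 - k\<^sup>2) * (k - cos (3 * u))\<^sup>2"
    using assms unfolding deltoid_eq z mem_Collect_eq P0_cubic_param .
  then have "k\<^sup>2 < 1" by (simp add: zero_less_mult_iff)
  then have k: "-1 < k" "k < 1" by (auto simp: power2_less_1_iff abs_less_iff)
  then have "0 < arccos k" "arccos k < pi" "cos (arccos k) = k"
    using arccos_lt_bounded[of k] by (auto simp: cos_arccos)
  then show ?thesis using that[of u "arccos k"] u z by (simp add: deltoid_map_def)
qed

lemma deltoid_map_in_deltoid_iff: "deltoid_map u v \<in> deltoid \<longleftrightarrow> deltoid_weight u v \<noteq> 0"
  by (simp add: deltoid_eq P0_deltoid_map)

section \<open>Change of variables\<close>

text \<open>A linear map matching orthonormal bases pulls boxes back to boxes with the same side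
  lengths. It identifies Lebesgue measure on \<open>real^2\<close>, where variables are changed,
  with that on \<open>real \<times> real\<close> and on \<open>complex\<close>.\<close>

lemma distr_lborel_linear:
  fixes h :: "'a::euclidean_space \<Rightarrow> 'b::euclidean_space"
  assumes "linear h" and bij: "bij_betw h Basis Basis"
  shows "distr lborel borel h = lborel"
proof (rule lborel_eqI[symmetric])
  interpret h: linear h by fact
  have cont: "continuous_on UNIV h" using assms(1) by (rule linear_continuous_on[OF linear_conv_bounded_linear[THEN iffD1]])
  then have [measurable]: "h \<in> borel_measurable borel" by (rule borel_measurable_continuous_onI)
  have inner: "h x \<bullet> h b = x \<bullet> b" if "b \<in> Basis" for x b
  proof -
    have "h x = (\<Sum>c\<in>Basis. (x \<bullet> c) *\<^sub>R h c)"
      by (subst euclidean_representation[of x, symmetric]) (simp only: h.sum h.scale)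
    then have "h x \<bullet> h b = (\<Sum>c\<in>Basis. (x \<bullet> c) * (h c \<bullet> h b))"
      by (simp add: inner_sum_left)
    also have "\<dots> = (\<Sum>c\<in>Basis. if c = b then x \<bullet> c else 0)"
    proof (intro sum.cong refl)
      fix c :: 'a assume c: "c \<in> Basis"
      have "h c \<in> Basis" "h b \<in> Basis" using bij c that by (auto simp: bij_betw_def)
      moreover have "h c = h b \<longleftrightarrow> c = b" using bij c that by (auto simp: bij_betw_def inj_on_eq_iff)
      ultimately show "(x \<bullet> c) * (h c \<bullet> h b) = (if c = b then x \<bullet> c else 0)"
        by (simp add: inner_Basis)
    qed
    also have "\<dots> = x \<bullet> b" using that by simp
    finally show ?thesis .
  qed
  fix l u :: 'b assume le: "\<And>b. b \<in> Basis \<Longrightarrow> l \<bullet> b \<le> u \<bullet> b"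
  define l' u' :: 'a where "l' = (\<Sum>b\<in>Basis. (l \<bullet> h b) *\<^sub>R b)" and "u' = (\<Sum>b\<in>Basis. (u \<bullet> h b) *\<^sub>R b)"
  have l'u': "l' \<bullet> b = l \<bullet> h b" "u' \<bullet> b = u \<bullet> h b" if "b \<in> Basis" for b
    using that by (simp_all add: l'_def u'_def)
  have Basis: "Basis = h ` Basis" using bij by (simp add: bij_betw_def)
  have "h -` box l u = box l' u'"
  proof -
    have "x \<in> h -` box l u \<longleftrightarrow> (\<forall>b\<in>Basis. l \<bullet> h b < h x \<bullet> h b \<and> h x \<bullet> h b < u \<bullet> h b)" for x
      unfolding vimage_eq mem_box by (subst Basis) simp
    then show ?thesis by (auto simp: mem_box inner l'u')
  qed
  then have "emeasure (distr lborel borel h) (box l u) = emeasure lborel (box l' u')"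
    by (simp add: emeasure_distr)
  also have "\<dots> = ennreal (\<Prod>b\<in>Basis. (u' - l') \<bullet> b)"
    using le bij by (intro emeasure_lborel_box) (auto simp: l'u' bij_betw_def)
  also have "(\<Prod>b\<in>Basis. (u' - l') \<bullet> b) = (\<Prod>b\<in>Basis. (u - l) \<bullet> h b)"
    by (intro prod.cong refl) (simp add: inner_diff_left l'u')
  also have "\<dots> = (\<Prod>b\<in>Basis. (u - l) \<bullet> b)"
    by (rule prod.reindex_bij_betw[OF bij])
  finally show "emeasure (distr lborel borel h) (box l u) = ennreal (\<Prod>b\<in>Basis. (u - l) \<bullet> b)" .
qed simp

lemma Basis_vec2: "(Basis :: (real^2) set) = {axis 1 1, axis 2 1}"
  by (auto simp: Basis_vec_def UNIV_2)

lemma distr_lborel_vec2_prod: "distr lborel borel (\<lambda>x::real^2. (x $ 1, x $ 2)) = lborel"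
proof (rule distr_lborel_linear)
  show "linear (\<lambda>x::real^2. (x $ 1, x $ 2))" by (rule linearI) auto
  show "bij_betw (\<lambda>x::real^2. (x $ 1, x $ 2)) Basis Basis"
    unfolding Basis_vec2 by (auto simp: bij_betw_def inj_on_def Basis_prod_def axis_def)
qed

lemma distr_lborel_vec2_complex: "distr lborel borel (\<lambda>x::real^2. Complex (x $ 1) (x $ 2)) = lborel"
proof (rule distr_lborel_linear)
  show "linear (\<lambda>x::real^2. Complex (x $ 1) (x $ 2))"
    by (rule linearI) (auto simp: complex_eq_iff)
  show "bij_betw (\<lambda>x::real^2. Complex (x $ 1) (x $ 2)) Basis Basis"
    unfolding Basis_vec2 by (auto simp: bij_betw_def inj_on_def Basis_complex_def axis_def complex_eq_iff)
qed

lemma has_absolute_integral_change_of_variables_real: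
  fixes f :: "real^'m::{finite,wellorder} \<Rightarrow> real" and g :: "real^'m::_ \<Rightarrow> real^'m::_"
  assumes S: "S \<in> sets lebesgue"
    and der_g: "\<And>x. x \<in> S \<Longrightarrow> (g has_derivative g' x) (at x within S)"
    and inj: "inj_on g S"
  shows "(\<lambda>x. \<bar>det (matrix (g' x))\<bar> * f (g x)) absolutely_integrable_on S \<and>
           integral S (\<lambda>x. \<bar>det (matrix (g' x))\<bar> * f (g x)) = b
     \<longleftrightarrow> f absolutely_integrable_on (g ` S) \<and> integral (g ` S) f = b"
  using has_absolute_integral_change_of_variables[OF S der_g inj, of "\<lambda>x. vec (f x) :: real^1" "vec b"]
  by (simp add: absolutely_integrable_on_1_iff integral_on_1_eq)

definition deltoid_vec :: "real^2 \<Rightarrow> real^2" where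
  "deltoid_vec x = (\<chi> i. if i = 1 then Re (deltoid_map (x $ 1) (x $ 2)) else Im (deltoid_map (x $ 1) (x $ 2)))"

definition deltoid_vec_deriv :: "real^2 \<Rightarrow> real^2 \<Rightarrow> real^2" where
  "deltoid_vec_deriv x h = (\<chi> i. if i = 1
     then ((- 2 * sin (2 * x $ 1) - 2 * cos (x $ 2) * sin (x $ 1)) * h $ 1 - 2 * sin (x $ 2) * cos (x $ 1) * h $ 2) / 3
     else ((- 2 * cos (2 * x $ 1) + 2 * cos (x $ 2) * cos (x $ 1)) * h $ 1 - 2 * sin (x $ 2) * sin (x $ 1) * h $ 2) / 3)"

lemma has_derivative_vec_lambda:
  fixes f :: "'n::finite \<Rightarrow> 'a::real_normed_vector \<Rightarrow> real"
  assumes "\<And>i. (f i has_derivative f' i) (at x within S)"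
  shows "((\<lambda>x. \<chi> i. f i x) has_derivative (\<lambda>h. \<chi> i. f' i h)) (at x within S)"
  unfolding has_derivative_componentwise_within[of "\<lambda>x. \<chi> i. f i x"]
  using assms by (auto simp: Basis_vec_def inner_axis)

lemma has_derivative_deltoid_vec: "(deltoid_vec has_derivative deltoid_vec_deriv x) (at x within S)"
proof -
  have [derivative_intros]: "((\<lambda>x. x $ i) has_derivative (\<lambda>h. h $ i)) (at x within S)" for i :: 2 and x :: "real^2"
    by (rule bounded_linear.has_derivative[OF bounded_linear_vec_nth has_derivative_ident])
  show ?thesis
    unfolding deltoid_vec_def[abs_def] deltoid_vec_deriv_def[abs_def]
  proof (rule has_derivative_vec_lambda)
    fix i :: 2
    show "((\<lambda>x. if i = 1 then Re (deltoid_map (x $ 1) (x $ 2)) else Im (deltoid_map (x $ 1) (x $ 2)))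
      has_derivative (\<lambda>h. if i = 1
     then ((- 2 * sin (2 * x $ 1) - 2 * cos (x $ 2) * sin (x $ 1)) * h $ 1 - 2 * sin (x $ 2) * cos (x $ 1) * h $ 2) / 3
     else ((- 2 * cos (2 * x $ 1) + 2 * cos (x $ 2) * cos (x $ 1)) * h $ 1 - 2 * sin (x $ 2) * sin (x $ 1) * h $ 2) / 3)) (at x within S)"
      unfolding deltoid_map_def
      by (cases "i = 1") (auto intro!: derivative_eq_intros simp: fun_eq_iff field_simps)
  qed
qed

lemma det_deltoid_vec_deriv:
  "\<bar>det (matrix (deltoid_vec_deriv x))\<bar> = 4 / 9 * deltoid_weight (x $ 1) (x $ 2)"
proof -
  define u v where "u = x $ 1" and "v = x $ 2"
  \<comment> \<open>The sines and cosines become free letters here; the trigonometric identities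
    enter only afterwards, through \<open>3 * u = 2 * u + u\<close>.\<close>
  have alg: "(- 2 * S - 2 * c * s) / 3 * (- (2 * t * s) / 3) - (- (2 * t * k) / 3) * ((- 2 * C + 2 * c * k) / 3)
      = 4 / 9 * (t * (S * s - C * k) + c * t * (s * s) + c * t * (k * k))" for S C s k c t :: real
    by (simp add: field_simps)
  have "det (matrix (deltoid_vec_deriv x)) = (- 2 * sin (2 * u) - 2 * cos v * sin u) / 3 * (- (2 * sin v * sin u) / 3)
      - (- (2 * sin v * cos u) / 3) * ((- 2 * cos (2 * u) + 2 * cos v * cos u) / 3)"
    by (simp add: det_2 matrix_def deltoid_vec_deriv_def axis_def u_def v_def)
  also have "\<dots> = 4 / 9 * (sin v * (sin (2 * u) * sin u - cos (2 * u) * cos u)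
        + cos v * sin v * (sin u * sin u) + cos v * sin v * (cos u * cos u))"
    by (rule alg)
  also have "\<dots> = 4 / 9 * (sin v * (cos v - cos (2 * u + u)))"
  proof -
    have "sin u * sin u = 1 - cos u * cos u"
      using sin_squared_eq[of u] by (simp add: power2_eq_square)
    then show ?thesis unfolding cos_add by (simp only:) (simp add: algebra_simps)
  qed
  finally show ?thesis unfolding deltoid_weight_def u_def[symmetric] v_def[symmetric]
    by (simp only: abs_mult) simp
qed

section \<open>Labelling the roots to obtain injective pieces\<close>

text \<open>A strict total order on the complex numbers, with Borel measurable comparison, serves to
  label the three roots.\<close>

definition lex_less :: "complex \<Rightarrow> complex \<Rightarrow> bool" where
  "lex_less a b \<longleftrightarrow> Re a < Re b \<or> Re a = Re b \<and> Im a < Im b"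

lemma lex_less_rank:
  assumes "finite R" "a \<in> R" "b \<in> R" "card {r \<in> R. lex_less r a} = card {r \<in> R. lex_less r b}"
  shows "a = b"
proof -
  have *: "card {r \<in> R. lex_less r a} < card {r \<in> R. lex_less r b}" if "lex_less a b" "a \<in> R" for a b
  proof (rule psubset_card_mono)
    show "finite {r \<in> R. lex_less r b}" using assms by simp
    have "{r \<in> R. lex_less r a} \<subseteq> {r \<in> R. lex_less r b}" "a \<notin> {r \<in> R. lex_less r a}"
      "a \<in> {r \<in> R. lex_less r b}"
      using that by (auto simp: lex_less_def)
    then show "{r \<in> R. lex_less r a} \<subset> {r \<in> R. lex_less r b}" by blast
  qed
  have "lex_less a b \<or> lex_less b a \<or> a = b" by (auto simp: lex_less_def complex_eq_iff)
  then show ?thesis using *[of a b] *[of b a] assms by auto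
qed

text \<open>The claim is Vieta's formula: for unimodular numbers of product 1, conjugation exchanges
  the first and second elementary symmetric functions, here \<open>3 * z\<close> and
  \<open>3 * cnj z\<close>.\<close>

lemma deltoid_map_roots:
  fixes u v :: real
  defines "z \<equiv> deltoid_map u v"
  shows "{X. X ^ 3 - 3 * z * X\<^sup>2 + 3 * cnj z * X - 1 = 0} = {cis (- 2 * u), cis (u + v), cis (u - v)}"
proof -
  define U B C where "U = cis (- 2 * u)" and "B = cis (u + v)" and "C = cis (u - v)"
  have BC: "B + C = 2 * of_real (cos v) * cis u"
    by (simp add: B_def C_def complex_eq_iff cos_add cos_diff sin_add sin_diff)
  then have z: "3 * z = U + B + C"
    unfolding z_def deltoid_map_def add.assoc BC U_def by simp
  have "cnj (3 * z) = U * B + U * C + B * C"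
    unfolding z by (simp add: U_def B_def C_def cis_cnj cis_mult)
  then have z': "3 * cnj z = U * B + U * C + B * C" by simp
  have "U * B * C = 1" by (simp add: U_def B_def C_def cis_mult)
  then have "X ^ 3 - 3 * z * X\<^sup>2 + 3 * cnj z * X - 1 = (X - U) * (X - B) * (X - C)" for X
    unfolding z z' by (simp add: power2_eq_square power3_eq_cube algebra_simps)
  then show ?thesis by (auto simp: U_def B_def C_def)
qed

text \<open>
  On the torus each point of the deltoid is hit finitely often, once for every choice of a root
  \<open>exp (-2\<i>u)\<close> of its cubic and of the signs of \<open>exp (\<i>u)\<close> and \<open>sin v\<close>. A piece fixes the signs and
  the lexicographic rank of the chosen root among the three roots, which makes the map injective there.
\<close>

definition deltoid_piece :: "bool \<times> bool \<times> bool \<times> bool \<Rightarrow> (real^2) set" where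
  "deltoid_piece = (\<lambda>(p, q, s, t). {x. 0 \<le> x $ 1 \<and> x $ 1 < 2 * pi \<and> 0 \<le> x $ 2 \<and> x $ 2 < 2 * pi \<and>
      deltoid_weight (x $ 1) (x $ 2) \<noteq> 0 \<and> (x $ 1 < pi \<longleftrightarrow> s) \<and> (x $ 2 < pi \<longleftrightarrow> t) \<and>
      (lex_less (cis (x $ 1 + x $ 2)) (cis (- 2 * x $ 1)) \<longleftrightarrow> p) \<and>
      (lex_less (cis (x $ 1 - x $ 2)) (cis (- 2 * x $ 1)) \<longleftrightarrow> q)})"

text \<open>Equal images have the same three roots. The comparison flags fix the rank of the chosen
  root, hence \<open>cis (- 2 * u)\<close>; the choice of halves then resolves \<open>u\<close>
  modulo \<open>pi\<close> and the sign ambiguity of \<open>v\<close> given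
  \<open>cos v\<close>.\<close>

lemma deltoid_map_inj:
  assumes uv: "0 \<le> u" "u < 2 * pi" "0 \<le> v" "v < 2 * pi" "deltoid_weight u v \<noteq> 0"
    and uv': "0 \<le> u'" "u' < 2 * pi" "0 \<le> v'" "v' < 2 * pi" "deltoid_weight u' v' \<noteq> 0"
    and eq: "deltoid_map u v = deltoid_map u' v'"
    and half: "u < pi \<longleftrightarrow> u' < pi" "v < pi \<longleftrightarrow> v' < pi"
    and lex: "lex_less (cis (u + v)) (cis (- 2 * u)) \<longleftrightarrow> lex_less (cis (u' + v')) (cis (- 2 * u'))"
      "lex_less (cis (u - v)) (cis (- 2 * u)) \<longleftrightarrow> lex_less (cis (u' - v')) (cis (- 2 * u'))"
  shows "u = u' \<and> v = v'"
proof -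
  define R where "R = {cis (- 2 * u), cis (u + v), cis (u - v)}"
  have R': "R = {cis (- 2 * u'), cis (u' + v'), cis (u' - v')}"
    using deltoid_map_roots[of u v] deltoid_map_roots[of u' v'] unfolding R_def eq by simp
  \<comment> \<open>The rank is the sum of the two flags because \<open>sin v \<noteq> 0\<close>
    keeps \<open>cis (u + v)\<close> and \<open>cis (u - v)\<close> apart.\<close>
  have card: "card {r \<in> {cis (- 2 * u), cis (u + v), cis (u - v)}. lex_less r (cis (- 2 * u))} =
     of_bool (lex_less (cis (u + v)) (cis (- 2 * u))) + of_bool (lex_less (cis (u - v)) (cis (- 2 * u)))"
    if "deltoid_weight u v \<noteq> 0" for u v
  proof -
    have "sin v \<noteq> 0" using that by (auto simp: deltoid_weight_def)
    then have "cis (u + v) \<noteq> cis (u - v)"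
      using cmod_cis_diff[of "u + v" "u - v"] by auto
    moreover have "\<not> lex_less x x" for x by (simp add: lex_less_def)
    ultimately have "{r \<in> {cis (- 2 * u), cis (u + v), cis (u - v)}. lex_less r (cis (- 2 * u))} =
        (if lex_less (cis (u + v)) (cis (- 2 * u)) then {cis (u + v)} else {}) \<union>
        (if lex_less (cis (u - v)) (cis (- 2 * u)) then {cis (u - v)} else {})"
      by auto
    then show ?thesis using \<open>cis (u + v) \<noteq> cis (u - v)\<close> by auto
  qed
  have U: "cis (- 2 * u) = cis (- 2 * u')"
  proof (rule lex_less_rank)
    show "finite R" "cis (- 2 * u) \<in> R" by (simp_all add: R_def)
    show "cis (- 2 * u') \<in> R" by (simp add: R')
    show "card {r \<in> R. lex_less r (cis (- 2 * u))} = card {r \<in> R. lex_less r (cis (- 2 * u'))}"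
      using card[OF uv(5)] card[OF uv'(5)] lex unfolding R_def[symmetric] R'[symmetric] by simp
  qed
  have u: "u = u'"
  proof -
    have "sin ((- 2 * u - - 2 * u') / 2) = 0"
      using cmod_cis_diff[of "- 2 * u" "- 2 * u'"] U by simp
    moreover have "(- 2 * u - - 2 * u') / 2 = u' - u" by simp
    ultimately have "sin (u' - u) = 0" by (simp only:)
    moreover have "\<bar>u' - u\<bar> < pi" using uv uv' half by auto
    ultimately show ?thesis using sin_eq_0_pi[of "u' - u"] by (simp add: abs_less_iff)
  qed
  have cos: "cos v = cos v'"
    using eq U unfolding deltoid_map_def u by simp
  have "v = v'"
  proof (cases "v < pi")
    case True
    then show ?thesis using half(2) by (intro cos_inj_pi[OF uv(3) _ uv'(3) _ cos]) simp_all
  next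
    case False
    have "2 * pi - v = 2 * pi - v'"
    proof (rule cos_inj_pi)
      show "cos (2 * pi - v) = cos (2 * pi - v')" using cos by simp
    qed (use False half(2) uv uv' in linarith)+
    then show ?thesis by simp
  qed
  then show ?thesis using u by simp
qed

lemma borel_measurable_vec2_nth [measurable]:
  "(\<lambda>x :: real^2. x $ i) \<in> borel_measurable borel"
  by (intro borel_measurable_continuous_onI continuous_intros)

lemma deltoid_weight_measurable [measurable (raw)]:
  assumes [measurable]: "f \<in> borel_measurable M" "g \<in> borel_measurable M"
  shows "(\<lambda>x. deltoid_weight (f x) (g x)) \<in> borel_measurable M"
  unfolding deltoid_weight_def by measurable

lemma deltoid_map_measurable [measurable (raw)]:
  assumes [measurable]: "f \<in> borel_measurable M" "g \<in> borel_measurable M"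
  shows "(\<lambda>x. deltoid_map (f x) (g x)) \<in> borel_measurable M"
  unfolding deltoid_map_def cis_conv_exp by measurable

lemma sets_deltoid_piece [measurable]: "deltoid_piece i \<in> sets borel"
  unfolding deltoid_piece_def lex_less_def by (cases i) (simp, measurable)

lemma deltoid_vec_piece_cover:
  assumes "Complex (y $ 1) (y $ 2) \<in> deltoid"
  shows "y \<in> (\<Union>i. deltoid_vec ` deltoid_piece i)"
proof -
  obtain u v where uv: "0 \<le> u" "u < 2 * pi" "0 < v" "v < pi" "Complex (y $ 1) (y $ 2) = deltoid_map u v"
    using deltoid_map_surj[OF assms] by metis
  define x :: "real^2" where "x = vector [u, v]"
  have x: "x $ 1 = u" "x $ 2 = v" by (simp_all add: x_def)
  have "deltoid_weight u v \<noteq> 0" using assms uv(5) deltoid_map_in_deltoid_iff by simp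
  then have "x \<in> deltoid_piece (lex_less (cis (u + v)) (cis (- 2 * u)),
      lex_less (cis (u - v)) (cis (- 2 * u)), u < pi, v < pi)"
    using uv by (simp add: deltoid_piece_def x)
  moreover have "y = deltoid_vec x"
    using uv(5) by (simp add: deltoid_vec_def x vec_eq_iff forall_2 complex_eq_iff)
  ultimately show ?thesis by blast
qed

lemma inj_on_deltoid_vec: "inj_on deltoid_vec (deltoid_piece i)"
proof (rule inj_onI)
  fix x y assume *: "x \<in> deltoid_piece i" "y \<in> deltoid_piece i" "deltoid_vec x = deltoid_vec y"
  then have "deltoid_map (x $ 1) (x $ 2) = deltoid_map (y $ 1) (y $ 2)"
    by (simp add: deltoid_vec_def vec_eq_iff forall_2 complex_eq_iff)
  then have "x $ 1 = y $ 1 \<and> x $ 2 = y $ 2"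
    using *(1,2) by (cases i) (intro deltoid_map_inj; simp add: deltoid_piece_def)
  then show "x = y" by (simp add: vec_eq_iff forall_2)
qed

lemma absolutely_integrable_finite_UN:
  fixes f :: "'a::euclidean_space \<Rightarrow> 'b::euclidean_space"
  assumes "finite I" "\<And>i. i \<in> I \<Longrightarrow> f absolutely_integrable_on A i"
  shows "f absolutely_integrable_on (\<Union>i\<in>I. A i)"
  using assms by (induction I rule: finite_induct) (auto intro: absolutely_integrable_Un)

text \<open>Each of the 16 pieces maps injectively with Jacobian
  \<open>4 / 9 * deltoid_weight\<close>, so it contributes at most \<open>9 / 4\<close> times the
  integral of \<open>F\<close>, and 16 times 9/4 is 36. Integrability of \<open>F\<close>, which may
  be unbounded near the boundary, comes from boundedness of its pullback times the weight.\<close>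

lemma deltoid_integral:
  fixes F :: "complex \<Rightarrow> real"
  assumes Fm [measurable]: "F \<in> borel_measurable borel"
    and F0: "\<And>z. 0 \<le> F z" and F_out: "\<And>z. z \<notin> deltoid \<Longrightarrow> F z = 0"
    and bound: "\<And>u v. F (deltoid_map u v) * deltoid_weight u v \<le> K"
  shows "integrable lborel F"
    and "set_integrable lborel {0..<2*pi}
      (\<lambda>u. LBINT v:{0..<2*pi}. F (deltoid_map u v) * deltoid_weight u v)"
    and "(LBINT u:{0..<2*pi}. LBINT v:{0..<2*pi}. F (deltoid_map u v) * deltoid_weight u v)
      \<le> 36 * (LINT z|lborel. F z)"
proof -
  define T :: "(real^2) set" where "T = {x. 0 \<le> x $ 1 \<and> x $ 1 < 2 * pi \<and> 0 \<le> x $ 2 \<and> x $ 2 < 2 * pi}"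
  define G where "G x = F (deltoid_map (x $ 1) (x $ 2)) * deltoid_weight (x $ 1) (x $ 2)" for x :: "real^2"
  define F' where "F' y = F (Complex (y $ 1) (y $ 2))" for y :: "real^2"
  have Complex_measurable[measurable]: "(\<lambda>x :: real^2. Complex (x $ 1) (x $ 2)) \<in> borel_measurable borel"
    unfolding Complex_eq by measurable
  have [measurable]: "G \<in> borel_measurable borel" unfolding G_def by measurable
  have [measurable]: "F' \<in> borel_measurable borel" unfolding F'_def by measurable
  have [measurable]: "T \<in> sets borel" unfolding T_def by measurable
  have G0: "0 \<le> G x" and GK: "G x \<le> K" for x
    using F0 bound by (simp_all add: G_def deltoid_weight_nonneg)
  have "T \<subseteq> cbox (vector [0, 0]) (vector [2 * pi, 2 * pi])"
    by (auto simp: T_def mem_box_cart forall_2)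
  then have T_fin: "emeasure lborel T < \<infinity>"
    by (intro emeasure_bounded_finite bounded_subset[OF bounded_cbox])
  have int_sub: "integrable lborel (\<lambda>x. indicator A x * G x)" if "A \<subseteq> T" and [measurable]: "A \<in> sets borel" for A
    by (rule integrableI_bounded_set[where A = T and B = K])
      (use that T_fin G0 GK in \<open>auto simp: indicator_def order_trans[OF G0 GK]\<close>)
  have piece_sub: "deltoid_piece i \<subseteq> T" for i
    by (cases i) (auto simp: deltoid_piece_def T_def)
  have piece: "F' absolutely_integrable_on deltoid_vec ` deltoid_piece i"
    "integral (deltoid_vec ` deltoid_piece i) F' = 4 / 9 * (LINT x|lborel. indicator (deltoid_piece i) x * G x)" for i
  proof -
    define b where "b = 4 / 9 * (LINT x|lborel. indicator (deltoid_piece i) x * G x)"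
    have eq: "(\<lambda>x. \<bar>det (matrix (deltoid_vec_deriv x))\<bar> * F' (deltoid_vec x)) = (\<lambda>x. 4 / 9 * G x)"
      by (auto simp: fun_eq_iff det_deltoid_vec_deriv G_def F'_def deltoid_vec_def)
    have int: "integrable lborel (\<lambda>x. indicator (deltoid_piece i) x *\<^sub>R (4 / 9 * G x))"
      using integrable_mult_right[OF int_sub[OF piece_sub sets_deltoid_piece], of "4 / 9" i] by (simp add: mult_ac)
    then have abs: "(\<lambda>x. 4 / 9 * G x) absolutely_integrable_on deltoid_piece i"
      unfolding set_integrable_def by (subst integrable_completion) auto
    have "integral (deltoid_piece i) (\<lambda>x. 4 / 9 * G x) = (LINT x:deltoid_piece i|lebesgue. 4 / 9 * G x)"
      using set_lebesgue_integral_eq_integral(2)[OF abs] by simp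
    also have "\<dots> = (LINT x:deltoid_piece i|lborel. 4 / 9 * G x)"
      unfolding set_lebesgue_integral_def by (rule integral_completion) auto
    also have "\<dots> = b"
      by (simp add: b_def set_lebesgue_integral_def mult_ac flip: integral_mult_right_zero)
    finally have "integral (deltoid_piece i) (\<lambda>x. 4 / 9 * G x) = b" .
    with abs have "F' absolutely_integrable_on deltoid_vec ` deltoid_piece i \<and>
        integral (deltoid_vec ` deltoid_piece i) F' = b"
      using has_absolute_integral_change_of_variables_real[of "deltoid_piece i" deltoid_vec deltoid_vec_deriv F' b,
          OF _ has_derivative_deltoid_vec inj_on_deltoid_vec]
      unfolding eq by simp
    then show "F' absolutely_integrable_on deltoid_vec ` deltoid_piece i"
      "integral (deltoid_vec ` deltoid_piece i) F' = b" by auto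
  qed
  have "F' absolutely_integrable_on (\<Union>i. deltoid_vec ` deltoid_piece i)"
    by (intro absolutely_integrable_finite_UN piece) auto
  then have "(\<lambda>y. if y \<in> (\<Union>i. deltoid_vec ` deltoid_piece i) then F' y else 0) absolutely_integrable_on UNIV"
    by (simp only: absolutely_integrable_restrict_UNIV)
  \<comment> \<open>The images of the pieces cover the domain, and \<open>F\<close> vanishes outside
    it.\<close>
  moreover have "(\<lambda>y. if y \<in> (\<Union>i. deltoid_vec ` deltoid_piece i) then F' y else 0) = F'"
    using deltoid_vec_piece_cover F_out by (fastforce simp: F'_def)
  ultimately have F'_abs: "F' absolutely_integrable_on UNIV" by simp
  then have F'_int: "integrable lborel F'"
    by (simp add: set_integrable_def integrable_completion)
  then show F_int: "integrable lborel F"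
    using integrable_distr_eq[of "\<lambda>x :: real^2. Complex (x $ 1) (x $ 2)" lborel borel F]
    by (simp add: distr_lborel_vec2_complex F'_def[abs_def])
  have F'_eq: "integral UNIV F' = (LINT z|lborel. F z)"
  proof -
    have "integral UNIV F' = (LINT y|lebesgue. F' y)"
      using set_lebesgue_integral_eq_integral(2)[OF F'_abs] by (simp add: set_lebesgue_integral_def)
    also have "\<dots> = (LINT y|lborel. F' y)" by (rule integral_completion) auto
    also have "\<dots> = (LINT z|lborel. F z)"
      using integral_distr[of "\<lambda>x :: real^2. Complex (x $ 1) (x $ 2)" lborel borel F]
      by (simp add: distr_lborel_vec2_complex F'_def[abs_def])
    finally show ?thesis .
  qed
  have piece_le: "(LINT x|lborel. indicator (deltoid_piece i) x * G x) \<le> 9 / 4 * (LINT z|lborel. F z)" for i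
  proof -
    have "integral (deltoid_vec ` deltoid_piece i) F' \<le> integral UNIV F'"
      using piece(1)[of i] F'_abs F0 by (intro integral_subset_le) (auto simp: absolutely_integrable_on_def F'_def)
    then show ?thesis unfolding piece F'_eq by simp
  qed
  \<comment> \<open>The pieces partition \<open>T\<close> except for the zero set of the weight,
    where \<open>G\<close> vanishes anyway.\<close>
  have GT: "indicator T x * G x = (\<Sum>i\<in>UNIV. indicator (deltoid_piece i) x * G x)" for x
  proof (cases "x \<in> T \<and> G x \<noteq> 0")
    case True
    define i where "i = (lex_less (cis (x $ 1 + x $ 2)) (cis (- 2 * x $ 1)),
      lex_less (cis (x $ 1 - x $ 2)) (cis (- 2 * x $ 1)), x $ 1 < pi, x $ 2 < pi)"
    have "x \<in> deltoid_piece j \<longleftrightarrow> j = i" for j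
      using True by (cases j) (auto simp: deltoid_piece_def T_def i_def G_def)
    then have "(\<Sum>j\<in>UNIV. indicator (deltoid_piece j) x * G x) = (\<Sum>j\<in>UNIV. if j = i then G x else 0)"
      by (intro sum.cong refl) (auto simp: indicator_def)
    then show ?thesis using True by simp
  next
    case False
    then have "indicator (deltoid_piece i) x * G x = 0" for i
      using piece_sub[of i] by (auto simp: indicator_def)
    moreover have "indicator T x * G x = 0" using False by (auto simp: indicator_def)
    ultimately show ?thesis by (simp only: sum.neutral_const)
  qed
  have "(LINT x|lborel. indicator T x * G x) = (\<Sum>i\<in>UNIV. LINT x|lborel. indicator (deltoid_piece i) x * G x)"
    unfolding GT by (intro Bochner_Integration.integral_sum int_sub piece_sub sets_deltoid_piece)
  also have "\<dots> \<le> (\<Sum>i\<in>(UNIV :: (bool \<times> bool \<times> bool \<times> bool) set). 9 / 4 * (LINT z|lborel. F z))"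
    by (intro sum_mono piece_le)
  also have "\<dots> = 36 * (LINT z|lborel. F z)"
    by (simp add: card_prod)
  finally have main: "(LINT x|lborel. indicator T x * G x) \<le> 36 * (LINT z|lborel. F z)" .
  \<comment> \<open>The integral over \<open>T\<close> is moved to the product measure so that
    Fubini yields the iterated integral.\<close>
  define H where "H p = indicator {0..<2*pi} (fst p) * indicator {0..<2*pi} (snd p) *
     (F (deltoid_map (fst p) (snd p)) * deltoid_weight (fst p) (snd p))" for p
  have Hm[measurable]: "H \<in> borel_measurable borel" 
    unfolding H_def borel_prod[symmetric] by measurable
  have HG: "H (x $ 1, x $ 2) = indicator T x * G x" for x :: "real^2"
    by (auto simp: H_def G_def T_def indicator_def)
  have pm[measurable]: "(\<lambda>x :: real^2. (x $ 1, x $ 2)) \<in> borel_measurable borel"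
    by (intro borel_measurable_continuous_onI continuous_intros)
  have "integrable (distr lborel borel (\<lambda>x :: real^2. (x $ 1, x $ 2))) H"
    by (subst integrable_distr_eq) (use int_sub[of T] in \<open>auto simp: HG\<close>)
  then have H_int: "integrable (lborel \<Otimes>\<^sub>M lborel) H"
    unfolding distr_lborel_vec2_prod lborel_prod .
  have H_eq: "integral\<^sup>L (lborel \<Otimes>\<^sub>M lborel) H = (LINT x|lborel. indicator T x * G x)"
  proof -
    have "integral\<^sup>L (lborel \<Otimes>\<^sub>M lborel) H = integral\<^sup>L (distr lborel borel (\<lambda>x :: real^2. (x $ 1, x $ 2))) H"
      unfolding distr_lborel_vec2_prod lborel_prod ..
    also have "\<dots> = (LINT x|lborel. H (x $ 1, (x :: real^2) $ 2))"
      by (rule integral_distr) auto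
    finally show ?thesis unfolding HG .
  qed
  have inner: "(LINT v|lborel. H (u, v)) = indicator {0..<2*pi} u *\<^sub>R
      (LBINT v:{0..<2*pi}. F (deltoid_map u v) * deltoid_weight u v)" for u
    by (simp add: H_def set_lebesgue_integral_def mult.assoc)
  show "set_integrable lborel {0..<2*pi}
      (\<lambda>u. LBINT v:{0..<2*pi}. F (deltoid_map u v) * deltoid_weight u v)"
    using lborel_pair.integrable_fst'[OF H_int] unfolding set_integrable_def inner .
  have "(LBINT u:{0..<2*pi}. LBINT v:{0..<2*pi}. F (deltoid_map u v) * deltoid_weight u v)
      = integral\<^sup>L (lborel \<Otimes>\<^sub>M lborel) H"
    using lborel_pair.integral_fst'[OF H_int] unfolding inner set_lebesgue_integral_def .
  then show "(LBINT u:{0..<2*pi}. LBINT v:{0..<2*pi}. F (deltoid_map u v) * deltoid_weight u v)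
      \<le> 36 * (LINT z|lborel. F z)"
    using main H_eq by simp
qed

section \<open>Polynomials on the deltoid\<close>

text \<open>Both \<open>z\<close> and \<open>cnj z\<close> are Laurent polynomials in
  \<open>x\<close> with denominator \<open>x ^ m\<close>. Total degree at most \<open>n\<close>
  means that the factor \<open>x ^ (m * n)\<close> clears all denominators.\<close>

lemma bidegree_substitution:
  fixes a :: "nat \<Rightarrow> nat \<Rightarrow> complex"
  assumes f: "\<And>z. f z = (\<Sum>i\<le>n. \<Sum>j\<le>n. a i j * z ^ i * cnj z ^ j)"
    and deg: "\<And>i j. n < i + j \<Longrightarrow> a i j = 0"
    and A: "degree A \<le> 2 * m" and B: "degree B \<le> 2 * m"
  shows "\<exists>Q. degree Q \<le> 2 * m * n \<and> (\<forall>x z. x ^ m * z = poly A x \<longrightarrow> x ^ m * cnj z = poly B x \<longrightarrow>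
    poly Q x = x ^ (m * n) * f z)"
proof -
  define t where "t i j = smult (a i j) (A ^ i * B ^ j * monom 1 (m * (n - i - j)))" for i j
  define Q where "Q = (\<Sum>i\<le>n. \<Sum>j\<le>n. t i j)"
  have "degree (t i j) \<le> 2 * m * n" for i j
  proof (cases "n < i + j")
    case True
    then show ?thesis using deg by (simp add: t_def)
  next
    case False
    have "degree (A ^ i) \<le> 2 * m * i" "degree (B ^ j) \<le> 2 * m * j"
      using order_trans[OF degree_power_le mult_le_mono1[OF A, of i]]
        order_trans[OF degree_power_le mult_le_mono1[OF B, of j]] by auto
    then have "degree (A ^ i * B ^ j * monom 1 (m * (n - i - j))) \<le> 2 * m * i + 2 * m * j + m * (n - i - j)"
      by (intro order_trans[OF degree_mult_le] add_mono degree_monom_le) auto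
    also have "\<dots> \<le> 2 * m * (i + j + (n - i - j))" by (simp add: algebra_simps)
    also have "\<dots> = 2 * m * n" using False by simp
    finally show ?thesis unfolding t_def using degree_smult_le order_trans by blast
  qed
  then have "degree Q \<le> 2 * m * n"
    unfolding Q_def by (intro degree_sum_le) auto
  moreover have "poly Q x = x ^ (m * n) * f z" if z: "x ^ m * z = poly A x" "x ^ m * cnj z = poly B x" for x z
  proof -
    have "poly (t i j) x = x ^ (m * n) * (a i j * z ^ i * cnj z ^ j)" for i j
    proof (cases "n < i + j")
      case True
      then show ?thesis using deg by (simp add: t_def)
    next
      case False
      then have "m * n = m * i + m * j + m * (n - i - j)" by (simp flip: distrib_left)
      then have "x ^ (m * n) = (x ^ m) ^ i * (x ^ m) ^ j * x ^ (m * (n - i - j))"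
        by (metis power_add power_mult)
      then show ?thesis
        by (simp add: t_def poly_monom z[symmetric] power_mult_distrib)
    qed
    then show ?thesis
      by (simp add: Q_def poly_sum f sum_distrib_left)
  qed
  ultimately show ?thesis by blast
qed

text \<open>In \<open>x = cis u\<close> the denominator is \<open>x ^ 2\<close>, whence degree
  \<open>4 * n\<close>; the clearing factor has modulus 1 on the circle.\<close>

lemma pullback_poly_first:
  fixes a :: "nat \<Rightarrow> nat \<Rightarrow> complex"
  assumes f: "\<And>z. f z = (\<Sum>i\<le>n. \<Sum>j\<le>n. a i j * z ^ i * cnj z ^ j)"
    and deg: "\<And>i j. n < i + j \<Longrightarrow> a i j = 0"
  shows "\<exists>Q. degree Q \<le> 4 * n \<and> (\<forall>u. cmod (poly Q (cis u)) = cmod (f (deltoid_map u v)))"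
proof -
  define A where "A = [:1 / 3, 0, 0, 2 * of_real (cos v) / 3 :: complex:]"
  define B where "B = [:0, 2 * of_real (cos v) / 3, 0, 0, 1 / 3 :: complex:]"
  have "degree A \<le> 2 * 2" "degree B \<le> 2 * 2"
    unfolding A_def B_def by (auto intro!: order_trans[OF degree_pCons_le])
  then obtain Q where Q: "degree Q \<le> 2 * 2 * n"
    "\<And>x z. x ^ 2 * z = poly A x \<Longrightarrow> x ^ 2 * cnj z = poly B x \<Longrightarrow> poly Q x = x ^ (2 * n) * f z"
    using bidegree_substitution[of f a n A 2 B, OF f deg] by blast
  have "poly Q (cis u) = cis u ^ (2 * n) * f (deltoid_map u v)" for u
  proof (rule Q(2))
    define x where "x = cis u"
    have x: "x * cnj x = 1" "x \<noteq> 0" "cis (- 2 * u) = cnj x * cnj x" "cis (2 * u) = x * x"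
      by (simp_all add: x_def cis_cnj cis_mult)
    have xx: "x * (cnj x * y) = y" for y by (simp add: x(1) flip: mult.assoc)
    show "cis u ^ 2 * deltoid_map u v = poly A (cis u)"
      unfolding deltoid_map_def A_def x(3) x_def[symmetric]
      by (simp add: algebra_simps power2_eq_square x xx add_divide_distrib)
    have "cnj (deltoid_map u v) = (x * x + 2 * of_real (cos v) * cnj x) / 3"
      unfolding deltoid_map_def x(3) x_def[symmetric] by simp
    then show "cis u ^ 2 * cnj (deltoid_map u v) = poly B (cis u)"
      unfolding B_def x_def[symmetric]
      by (simp add: algebra_simps power2_eq_square x xx add_divide_distrib)
  qed
  then have "cmod (poly Q (cis u)) = cmod (f (deltoid_map u v))" for u
    by (simp add: norm_mult norm_power)
  then show ?thesis using Q(1) by auto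
qed

lemma pullback_poly_second:
  fixes a :: "nat \<Rightarrow> nat \<Rightarrow> complex"
  assumes f: "\<And>z. f z = (\<Sum>i\<le>n. \<Sum>j\<le>n. a i j * z ^ i * cnj z ^ j)"
    and deg: "\<And>i j. n < i + j \<Longrightarrow> a i j = 0"
  shows "\<exists>Q. degree Q \<le> 2 * n \<and> (\<forall>v. cmod (poly Q (cis v)) = cmod (f (deltoid_map u v)))"
proof -
  define A where "A = [:cis u / 3, cis (- 2 * u) / 3, cis u / 3:]"
  define B where "B = [:cis (- u) / 3, cis (2 * u) / 3, cis (- u) / 3:]"
  have "degree A \<le> 2 * 1" "degree B \<le> 2 * 1"
    unfolding A_def B_def by (auto intro!: order_trans[OF degree_pCons_le])
  then obtain Q where Q: "degree Q \<le> 2 * 1 * n"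
    "\<And>x z. x ^ 1 * z = poly A x \<Longrightarrow> x ^ 1 * cnj z = poly B x \<Longrightarrow> poly Q x = x ^ (1 * n) * f z"
    using bidegree_substitution[of f a n A 1 B, OF f deg] by blast
  have "poly Q (cis v) = cis v ^ (1 * n) * f (deltoid_map u v)" for v
  proof (rule Q(2))
    define x where "x = cis v"
    have x: "x * cnj x = 1" by (simp add: x_def cis_cnj cis_mult)
    have c: "2 * complex_of_real (cos v) = x + cnj x"
      by (simp add: x_def complex_eq_iff)
    have xx: "x * (cnj x * y) = y" for y by (simp add: x flip: mult.assoc)
    show "cis v ^ 1 * deltoid_map u v = poly A (cis v)"
      unfolding deltoid_map_def A_def c x_def[symmetric]
      by (simp add: algebra_simps x xx add_divide_distrib)
    have "cnj (deltoid_map u v) = (cis (2 * u) + (x + cnj x) * cis (- u)) / 3"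
      unfolding deltoid_map_def c by (simp add: cis_cnj add.commute)
    then show "cis v ^ 1 * cnj (deltoid_map u v) = poly B (cis v)"
      unfolding B_def x_def[symmetric]
      by (simp add: algebra_simps x xx add_divide_distrib)
  qed
  then have "cmod (poly Q (cis v)) = cmod (f (deltoid_map u v))" for v
    by (simp add: norm_mult norm_power)
  then show ?thesis using Q(1) by auto
qed

lemma set_integral_Ico_eq_Icc:
  fixes f :: "real \<Rightarrow> real"
  assumes [measurable]: "f \<in> borel_measurable borel"
  shows "(LBINT t:{a..<b}. f t) = (LBINT t:{a..b}. f t)"
  unfolding set_lebesgue_integral_def
proof (rule integral_cong_AE)
  show "AE t in lborel. indicator {a..<b} t *\<^sub>R f t = indicator {a..b} t *\<^sub>R f t"
    using AE_lborel_singleton[of b] by eventually_elim (auto simp: indicator_def)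
qed measurable

lemma cmod_deltoid_map_le: "cmod (deltoid_map u v) \<le> 1"
proof -
  have "cmod (cis (- 2 * u) + 2 * of_real (cos v) * cis u) \<le> 1 + 2 * \<bar>cos v\<bar>"
    using norm_triangle_ineq[of "cis (- 2 * u)" "2 * of_real (cos v) * cis u"] by (simp add: norm_mult)
  then have "cmod (cis (- 2 * u) + 2 * of_real (cos v) * cis u) \<le> 3"
    using abs_cos_le_one[of v] by linarith
  then show ?thesis by (simp add: deltoid_map_def norm_divide)
qed

text \<open>The weighted inequality is applied in \<open>v\<close> for every \<open>u\<close>, with
  a constant independent of \<open>u\<close>, and the unweighted one in \<open>u\<close> at fixed
  \<open>v0\<close>. The cost of the weight is thus paid in one variable only.\<close>

lemma pointwise_le_weighted_torus_integral:
  fixes a :: "nat \<Rightarrow> nat \<Rightarrow> complex"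
  assumes f: "\<And>z. f z = (\<Sum>i\<le>n. \<Sum>j\<le>n. a i j * z ^ i * cnj z ^ j)"
    and deg: "\<And>i j. n < i + j \<Longrightarrow> a i j = 0" and b: "b \<ge> 0"
  defines "I \<equiv> \<lambda>u. LBINT v:{0..<2*pi}. (cmod (f (deltoid_map u v)))\<^sup>2 * deltoid_weight u v powr b"
  assumes I: "set_integrable lborel {0..<2*pi} I"
  shows "(cmod (f (deltoid_map u0 v0)))\<^sup>2 \<le> (4 * real n + 1) * (2 * real n + 1) *
    (16384 * (2 * real n + 1) ^ 3) powr b * (LBINT u:{0..<2*pi}. I u)"
proof -
  define K where "K = (2 * real n + 1) * (16384 * (2 * real n + 1) ^ 3) powr b"
  have contf: "continuous_on UNIV f" unfolding f[abs_def] by (intro continuous_intros)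
  have [measurable]: "f \<in> borel_measurable borel" by (rule borel_measurable_continuous_onI[OF contf])
  have second: "(cmod (f (deltoid_map u v0)))\<^sup>2 \<le> K * I u" for u
  proof -
    obtain Q where Q: "degree Q \<le> 2 * n" "\<And>v. cmod (poly Q (cis v)) = cmod (f (deltoid_map u v))"
      using pullback_poly_second[of f a n u, OF f deg] by blast
    have "(cmod (poly Q (cis v0)))\<^sup>2 \<le> (real (2 * n) + 1) * (16384 * (real (2 * n) + 1) ^ 3) powr b *
        (LBINT v:{0..2*pi}. (cmod (poly Q (cis v)))\<^sup>2 * deltoid_weight u v powr b)"
      by (rule weighted_nikolskii[OF Q(1) _ b]) simp
    also have "(LBINT v:{0..2*pi}. (cmod (poly Q (cis v)))\<^sup>2 * deltoid_weight u v powr b) = I u"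
      unfolding I_def Q(2) by (rule set_integral_Ico_eq_Icc[symmetric]) measurable
    finally show ?thesis by (simp add: Q(2) K_def)
  qed
  have J0: "0 \<le> (LBINT u:{0..<2*pi}. (cmod (f (deltoid_map u v0)))\<^sup>2)"
    unfolding set_lebesgue_integral_def by (intro integral_nonneg_AE) auto
  obtain Q where Q: "degree Q \<le> 4 * n" "\<And>u. cmod (poly Q (cis u)) = cmod (f (deltoid_map u v0))"
    using pullback_poly_first[of f a n v0, OF f deg] by blast
  have "(cmod (poly Q (cis u0)))\<^sup>2 \<le> (real (4 * n) + 1) / (2 * pi) * (LBINT u:{0..2*pi}. (cmod (poly Q (cis u)))\<^sup>2)"
    by (rule nikolskii_unit_circle[OF Q(1)]) simp
  also have "(LBINT u:{0..2*pi}. (cmod (poly Q (cis u)))\<^sup>2) = (LBINT u:{0..<2*pi}. (cmod (f (deltoid_map u v0)))\<^sup>2)"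
    unfolding Q(2) by (rule set_integral_Ico_eq_Icc[symmetric]) measurable
  also have "(real (4 * n) + 1) / (2 * pi) * \<dots> \<le> (4 * real n + 1) * \<dots>"
  proof (rule mult_right_mono[OF _ J0])
    have "(4 * real n + 1) / (2 * pi) \<le> (4 * real n + 1) / 1"
      using pi_gt3 by (intro divide_left_mono) auto
    then show "(real (4 * n) + 1) / (2 * pi) \<le> 4 * real n + 1" by simp
  qed
  also have "\<dots> \<le> (4 * real n + 1) * (LBINT u:{0..<2*pi}. K * I u)"
  proof (rule mult_left_mono[OF set_integral_mono])
    have "set_integrable lborel {0..2*pi} (\<lambda>u. (cmod (f (deltoid_map u v0)))\<^sup>2)"
      unfolding deltoid_map_def f
      by (intro borel_integrable_atLeastAtMost' continuous_intros) auto
    then show "set_integrable lborel {0..<2*pi} (\<lambda>u. (cmod (f (deltoid_map u v0)))\<^sup>2)"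
      by (rule set_integrable_subset) auto
    show "set_integrable lborel {0..<2*pi} (\<lambda>u. K * I u)"
      using I by (rule set_integrable_mult_right)
  qed (use second in auto)
  also have "\<dots> = (4 * real n + 1) * (K * (LBINT u:{0..<2*pi}. I u))" by simp
  finally show ?thesis by (simp add: Q(2) K_def mult.assoc)
qed

section \<open>The invariant density and the final estimate\<close>

definition deltoid_density :: "real \<Rightarrow> complex \<Rightarrow> real" where
  "deltoid_density l z = indicator deltoid z * P0 z powr deltoid_exponent l"

lemma borel_measurable_deltoid_density [measurable]: "deltoid_density l \<in> borel_measurable borel"
proof -
  have [measurable]: "P0 \<in> borel_measurable borel"
    by (intro borel_measurable_continuous_onI continuous_on_P0)
  have [measurable]: "deltoid \<in> sets borel" using open_deltoid by (rule borel_open)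
  show ?thesis unfolding deltoid_density_def by measurable
qed

text \<open>The density contributes the weight to the power \<open>2 * deltoid_exponent l\<close>
  and the Jacobian one more, in total \<open>(2 * l - 2) / 3\<close>; this is nonnegative exactly
  when \<open>l \<ge> 1\<close>.\<close>

lemma deltoid_density_pullback:
  "deltoid_density l (deltoid_map u v) * deltoid_weight u v =
     (4 / 27) powr deltoid_exponent l * deltoid_weight u v powr ((2 * l - 2) / 3)"
proof (cases "deltoid_weight u v = 0")
  \<comment> \<open>Both sides are 0, also for \<open>l = 1\<close>, because
    \<open>0 powr 0 = 0\<close>.\<close>
  case True
  then show ?thesis by simp
next
  case False
  define w where "w = deltoid_weight u v"
  have w: "w > 0" using False deltoid_weight_nonneg[of u v] by (simp add: w_def)
  have "deltoid_density l (deltoid_map u v) * w = (4 / 27 * w\<^sup>2) powr deltoid_exponent l * w"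
    using False by (simp add: deltoid_density_def deltoid_map_in_deltoid_iff P0_deltoid_map w_def)
  also have "\<dots> = (4 / 27) powr deltoid_exponent l * (w powr (2 * deltoid_exponent l) * w powr 1)"
  proof -
    have "(w\<^sup>2) powr e = w powr (2 * e)" for e
      using w by (simp only: powr_numeral[symmetric] powr_powr)
    then show ?thesis using w by (subst powr_mult) simp_all
  qed
  also have "w powr (2 * deltoid_exponent l) * w powr 1 = w powr ((2 * l - 2) / 3)"
  proof -
    have "2 * deltoid_exponent l + 1 = (2 * l - 2) / 3"
      by (simp add: deltoid_exponent_def field_simps)
    then show ?thesis by (simp only: powr_add[symmetric])
  qed
  finally show ?thesis by (simp add: w_def)
qed

lemma deltoid_christoffel_bound:
  fixes a :: "nat \<Rightarrow> nat \<Rightarrow> complex"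
  assumes f: "\<And>z. f z = (\<Sum>i\<le>n. \<Sum>j\<le>n. a i j * z ^ i * cnj z ^ j)"
    and deg: "\<And>i j. n < i + j \<Longrightarrow> a i j = 0" and l: "l \<ge> 1" and z: "z \<in> deltoid"
  shows "integrable lborel (\<lambda>z. (cmod (f z))\<^sup>2 * deltoid_density l z)"
    and "(cmod (f z))\<^sup>2 \<le> (4 * real n + 1) * (2 * real n + 1) *
      (16384 * (2 * real n + 1) ^ 3) powr ((2 * l - 2) / 3) * (36 / (4 / 27) powr deltoid_exponent l) *
      (LINT z|lborel. (cmod (f z))\<^sup>2 * deltoid_density l z)"
proof -
  define b where "b = (2 * l - 2) / 3"
  have b: "b \<ge> 0" using l by (simp add: b_def)
  define c :: real where "c = (4 / 27) powr deltoid_exponent l"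
  have c: "c > 0" by (simp add: c_def)
  define F where "F z = (cmod (f z))\<^sup>2 * deltoid_density l z" for z
  have contf: "continuous_on S f" for S unfolding f[abs_def] by (intro continuous_intros)
  have [measurable]: "f \<in> borel_measurable borel" by (rule borel_measurable_continuous_onI[OF contf])
  have [measurable]: "F \<in> borel_measurable borel" unfolding F_def by measurable
  have F0: "0 \<le> F z" for z by (simp add: F_def deltoid_density_def)
  have F_out: "F z = 0" if "z \<notin> deltoid" for z using that by (simp add: F_def deltoid_density_def)
  have FZ: "F (deltoid_map u v) * deltoid_weight u v = c * ((cmod (f (deltoid_map u v)))\<^sup>2 * deltoid_weight u v powr b)" for u v
    using deltoid_density_pullback[of l u v] by (simp add: F_def c_def b_def mult.assoc)
  \<comment> \<open>The image of \<open>deltoid_map\<close> lies in the closed unit disc, so a bound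
    for \<open>f\<close> there bounds the pulled-back integrand.\<close>
  obtain M where M: "\<And>z. z \<in> cball 0 1 \<Longrightarrow> cmod (f z) \<le> M"
  proof -
    have "bounded (f ` cball 0 1)"
      by (intro compact_imp_bounded compact_continuous_image contf compact_cball)
    then show ?thesis using that unfolding bounded_iff by blast
  qed
  have bound: "F (deltoid_map u v) * deltoid_weight u v \<le> c * (M\<^sup>2 * 2 powr b)" for u v
    unfolding FZ using M[of "deltoid_map u v"] cmod_deltoid_map_le[of u v] c b
    by (intro mult_left_mono mult_mono power_mono powr_mono2 deltoid_weight_le_2 deltoid_weight_nonneg) auto
  note I = deltoid_integral[of F, OF _ F0 F_out bound]
  show "integrable lborel (\<lambda>z. (cmod (f z))\<^sup>2 * deltoid_density l z)"
    using I(1) by (simp add: F_def[abs_def])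
  define J where "J u = (LBINT v:{0..<2*pi}. (cmod (f (deltoid_map u v)))\<^sup>2 * deltoid_weight u v powr b)" for u
  have FJ: "(LBINT v:{0..<2*pi}. F (deltoid_map u v) * deltoid_weight u v) = c * J u" for u
    unfolding FZ J_def by simp
  have J_int: "set_integrable lborel {0..<2*pi} J"
    using I(2) c unfolding FJ by simp
  have "c * (LBINT u:{0..<2*pi}. J u) \<le> 36 * (LINT z|lborel. F z)"
    using I(3) unfolding FJ by simp
  then have J_le: "(LBINT u:{0..<2*pi}. J u) \<le> 36 / c * (LINT z|lborel. F z)"
    using c by (simp add: field_simps)
  obtain u0 v0 where "z = deltoid_map u0 v0" using deltoid_map_surj[OF z] by metis
  then have "(cmod (f z))\<^sup>2 \<le> (4 * real n + 1) * (2 * real n + 1) *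
      (16384 * (2 * real n + 1) ^ 3) powr b * (LBINT u:{0..<2*pi}. J u)"
    using pointwise_le_weighted_torus_integral[of f a n b u0 v0, OF f deg b] J_int
    unfolding J_def by simp
  also have "\<dots> \<le> (4 * real n + 1) * (2 * real n + 1) *
      (16384 * (2 * real n + 1) ^ 3) powr b * (36 / c * (LINT z|lborel. F z))"
    by (intro mult_left_mono J_le) auto
  finally show "(cmod (f z))\<^sup>2 \<le> (4 * real n + 1) * (2 * real n + 1) *
      (16384 * (2 * real n + 1) ^ 3) powr ((2 * l - 2) / 3) * (36 / (4 / 27) powr deltoid_exponent l) *
      (LINT z|lborel. (cmod (f z))\<^sup>2 * deltoid_density l z)"
    by (simp add: b_def c_def F_def)
qed

text \<open>The pointwise bound for the constant polynomial 1 of degree 0 makes the total mass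
  positive. This excludes the default value 0 of a divergent integral or of a division by
  zero.\<close>

lemma deltoid_const_pos:
  assumes "l \<ge> 1"
  shows "deltoid_const l > 0"
proof -
  define A :: real where "A = 16384 powr ((2 * l - 2) / 3) * (36 / (4 / 27) powr deltoid_exponent l)"
  have "(cmod 1)\<^sup>2 \<le> (4 * real 0 + 1) * (2 * real 0 + 1) *
      (16384 * (2 * real 0 + 1) ^ 3) powr ((2 * l - 2) / 3) * (36 / (4 / 27) powr deltoid_exponent l) *
      (LINT z|lborel. (cmod 1)\<^sup>2 * deltoid_density l z)"
    by (rule deltoid_christoffel_bound(2)[of "\<lambda>_. 1" "\<lambda>i j. if i + j = 0 then 1 else 0" 0, OF _ _ assms zero_in_deltoid])
      auto
  then have "1 \<le> A * (LINT z|lborel. deltoid_density l z)"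
    by (simp add: A_def)
  moreover have "A > 0" by (simp add: A_def)
  ultimately have "0 < (LINT z|lborel. deltoid_density l z)"
    by (metis less_le_trans zero_less_mult_pos zero_less_one)
  then show ?thesis
    by (simp add: deltoid_const_def set_lebesgue_integral_def deltoid_density_def)
qed

lemma L2_norm_eq:
  assumes "l \<ge> 1" and [measurable]: "f \<in> borel_measurable borel"
  shows "(L2_norm l f)\<^sup>2 = deltoid_const l * (LINT z|lborel. (cmod (f z))\<^sup>2 * deltoid_density l z)"
proof -
  have "deltoid_measure l = density lborel (\<lambda>z. ennreal (deltoid_const l * deltoid_density l z))"
    unfolding deltoid_measure_def by (intro arg_cong2[where f = density] ext refl)
      (auto simp: deltoid_density_def indicator_def)
  moreover have "0 \<le> deltoid_const l * deltoid_density l z" for z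
    using deltoid_const_pos[OF assms(1)] by (simp add: deltoid_density_def)
  ultimately have "(LINT z|deltoid_measure l. (cmod (f z))\<^sup>2) =
      (LINT z|lborel. (deltoid_const l * deltoid_density l z) *\<^sub>R (cmod (f z))\<^sup>2)"
    by (simp only:) (intro integral_density; auto)
  also have "\<dots> = (LINT z|lborel. deltoid_const l * ((cmod (f z))\<^sup>2 * deltoid_density l z))"
    by (intro Bochner_Integration.integral_cong refl) simp
  also have "\<dots> = deltoid_const l * (LINT z|lborel. (cmod (f z))\<^sup>2 * deltoid_density l z)"
    by simp
  finally have *: "(LINT z|deltoid_measure l. (cmod (f z))\<^sup>2) = \<dots>" .
  moreover have "0 \<le> (LINT z|deltoid_measure l. (cmod (f z))\<^sup>2)"
    by (intro integral_nonneg_AE) auto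
  ultimately show ?thesis unfolding L2_norm_def by simp
qed

theorem proposition5p1:
  fixes l :: real
  assumes "l \<ge> 1"
  shows "\<exists>C::real. \<forall>(P :: complex \<Rightarrow> complex) (\<mu>::real).
           polynomial_eigenvector l \<mu> P \<and> \<mu> \<noteq> 0 \<longrightarrow>
           sup_norm P \<le> C * \<mu> powr (l / 2) * L2_norm l P"
proof -
  define b where "b = (2 * l - 2) / 3"
  have b: "b \<ge> 0" using assms by (simp add: b_def)
  \<comment> \<open>For \<open>n \<ge> 1\<close> the factors \<open>4 * n + 1\<close> and
    \<open>2 * n + 1\<close> are at most \<open>5 * n\<close> and \<open>3 * n\<close>, giving 15,
    and \<open>442368 = 16384 * 3 ^ 3\<close>. The power of 4/3 comes from
    \<open>n ^ 2 \<le> 4 / 3 * \<mu>\<close>, and \<open>deltoid_const l\<close> from the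
    normalisation of the measure.\<close>
  define K where "K = 15 * 442368 powr b * (36 / (4 / 27) powr deltoid_exponent l) * (4 / 3) powr l / deltoid_const l"
  have const: "deltoid_const l > 0" by (rule deltoid_const_pos[OF assms])
  have K: "0 \<le> K" using const by (simp add: K_def)
  have "sup_norm P \<le> sqrt K * \<mu> powr (l / 2) * L2_norm l P"
    if P: "polynomial_eigenvector l \<mu> P" "\<mu> \<noteq> 0" for P \<mu>
  proof -
    obtain n a where n: "n \<ge> 1" "real n ^ 2 \<le> 4 / 3 * \<mu>"
      and f: "\<And>z. P z = (\<Sum>i\<le>n. \<Sum>j\<le>n. a i j * z ^ i * cnj z ^ j)"
      and deg: "\<And>i j. n < i + j \<Longrightarrow> a i j = 0"
      using polynomial_eigenvector_degree[OF P assms] by blast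
    have "0 < real n ^ 2" using n(1) by simp
    then have \<mu>: "\<mu> > 0" using n(2) by linarith
    define E where "E = (LINT z|lborel. (cmod (P z))\<^sup>2 * deltoid_density l z)"
    have E: "0 \<le> E" unfolding E_def by (intro integral_nonneg_AE) (auto simp: deltoid_density_def)
    have "continuous_on UNIV P" unfolding f[abs_def] by (intro continuous_intros)
    then have "P \<in> borel_measurable borel" by (rule borel_measurable_continuous_onI)
    then have L2: "(L2_norm l P)\<^sup>2 = deltoid_const l * E"
      unfolding E_def by (rule L2_norm_eq[OF assms])
    have L2_0: "0 \<le> L2_norm l P" unfolding L2_norm_def by (simp add: integral_nonneg_AE)
    have n': "1 \<le> real n" using n(1) by simp
    have growth: "(4 * real n + 1) * (2 * real n + 1) * (16384 * (2 * real n + 1) ^ 3) powr b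
        \<le> 15 * 442368 powr b * ((4 / 3) powr l * \<mu> powr l)"
    proof -
      have "(4 * real n + 1) * (2 * real n + 1) * (16384 * (2 * real n + 1) ^ 3) powr b
          \<le> (5 * real n) * (3 * real n) * (16384 * (3 * real n) ^ 3) powr b"
        using n' b by (intro mult_mono powr_mono2 power_mono) auto
      also have "\<dots> = 15 * 442368 powr b * (real n powr 2 * (real n powr 3) powr b)"
        using n' by (simp add: power_mult_distrib powr_mult power2_eq_square)
      also have "real n powr 2 * (real n powr 3) powr b = (real n ^ 2) powr l"
      proof -
        \<comment> \<open>Two powers of \<open>n\<close> come from the two applications of
          Nikolskii's inequality and \<open>3 * b\<close> from the weight; together they give
          \<open>\<mu> powr l\<close> for the squared norms.\<close>
        have "2 + 3 * b = 2 * l" by (simp add: b_def field_simps)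
        moreover have "real n ^ 2 = real n powr 2" using n' by simp
        ultimately show ?thesis by (simp only: powr_powr powr_add[symmetric])
      qed
      also have "\<dots> \<le> (4 / 3 * \<mu>) powr l"
        using n assms by (intro powr_mono2) auto
      also have "\<dots> = (4 / 3) powr l * \<mu> powr l"
        by (rule powr_mult)
      finally show ?thesis by (simp add: mult_left_mono)
    qed
    have "cmod (P z) \<le> sqrt K * \<mu> powr (l / 2) * L2_norm l P" if "z \<in> deltoid" for z
    proof (rule power2_le_imp_le)
      have "(cmod (P z))\<^sup>2 \<le> (4 * real n + 1) * (2 * real n + 1) *
          (16384 * (2 * real n + 1) ^ 3) powr b * (36 / (4 / 27) powr deltoid_exponent l) * E"
        using deltoid_christoffel_bound(2)[of P a n l z, OF f deg assms that] by (simp add: b_def E_def)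
      also have "\<dots> \<le> 15 * 442368 powr b * ((4 / 3) powr l * \<mu> powr l) * (36 / (4 / 27) powr deltoid_exponent l) * E"
        by (intro mult_right_mono growth E) auto
      also have "\<dots> = K * \<mu> powr l * (L2_norm l P)\<^sup>2"
        using const unfolding L2 K_def by (simp add: field_simps)
      also have "\<dots> = (sqrt K * \<mu> powr (l / 2) * L2_norm l P)\<^sup>2"
      proof -
        have "(\<mu> powr (l / 2))\<^sup>2 = \<mu> powr l" by (simp add: power2_eq_square flip: powr_add)
        then show ?thesis using K by (simp add: power_mult_distrib)
      qed
      finally show "(cmod (P z))\<^sup>2 \<le> (sqrt K * \<mu> powr (l / 2) * L2_norm l P)\<^sup>2" .
    qed (use K L2_0 in simp)
    then show ?thesis
      unfolding sup_norm_def using zero_in_deltoid by (intro cSUP_least) auto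
  qed
  then show ?thesis by blast
qed

end
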